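(* (1) Any torsion-free hyperbolic group is a CSA-group. (2) Any group acting freely on a $\Lambda$-tree is a CSA-group. (3) Any universally free group is a CSA-group.
   Context: A subgroup $H$ of a group $G$ is conjugately separated (malnormal) if $H\cap H^x=1$ for every $x\in G\setminus H$, where $H^x=x^{-1}Hx$. A group $G$ is a CSA-group if all its maximal abelian subgroups are conjugately separated. "Hyperbolic" means (finitely generated and) hyperbolic in the sense of Gromov. $\Lambda$ denotes an ordered abelian group; a group acts freely on a $\Lambda$-tree if it acts by isometries, without inversions, and no nontrivial element has a fixed point. A group is universally free if it has the same universal first-order theory (in the language of groups) as a nonabelian free group. *)

theory Defs
  imports Complex_Main "HOL-Algebra.Generated_Groups" "HOL-Algebra.Group_Action"
begin

section \<open>CSA-groups\<close>

definition conjugately_separated :: "('a, 'm) monoid_scheme \<Rightarrow> 'a set \<Rightarrow> bool" where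
  "conjugately_separated G H \<longleftrightarrow>
     subgroup H G \<and>
     (\<forall>x \<in> carrier G - H. H \<inter> (\<lambda>h. inv\<^bsub>G\<^esub> x \<otimes>\<^bsub>G\<^esub> h \<otimes>\<^bsub>G\<^esub> x) ` H = {\<one>\<^bsub>G\<^esub>})"

definition abelian_subgroup :: "('a, 'm) monoid_scheme \<Rightarrow> 'a set \<Rightarrow> bool" where
  "abelian_subgroup G H \<longleftrightarrow> subgroup H G \<and> comm_group (G\<lparr>carrier := H\<rparr>)"

definition maximal_abelian_subgroup :: "('a, 'm) monoid_scheme \<Rightarrow> 'a set \<Rightarrow> bool" where
  "maximal_abelian_subgroup G M \<longleftrightarrow>
     abelian_subgroup G M \<and> (\<forall>H. abelian_subgroup G H \<and> M \<subseteq> H \<longrightarrow> H = M)"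

definition csa_group :: "('a, 'm) monoid_scheme \<Rightarrow> bool" where
  "csa_group G \<longleftrightarrow>
     group G \<and> (\<forall>M. maximal_abelian_subgroup G M \<longrightarrow> conjugately_separated G M)"


section \<open>Words\<close>

text \<open>A letter \<open>(x, True)\<close> stands for \<open>x\<close>, and \<open>(x, False)\<close> for the inverse of \<open>x\<close>.\<close>

definition words :: "'a set \<Rightarrow> ('a \<times> bool) list set" where
  "words X = lists (X \<times> UNIV)"

definition letter_value :: "('a, 'm) monoid_scheme \<Rightarrow> 'a \<times> bool \<Rightarrow> 'a" where
  "letter_value G l = (if snd l then fst l else inv\<^bsub>G\<^esub> fst l)"

definition word_value :: "('a, 'm) monoid_scheme \<Rightarrow> ('a \<times> bool) list \<Rightarrow> 'a" where
  "word_value G w = foldr (\<lambda>l y. letter_value G l \<otimes>\<^bsub>G\<^esub> y) w \<one>\<^bsub>G\<^esub>"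

definition reduced_word :: "('a \<times> bool) list \<Rightarrow> bool" where
  "reduced_word w \<longleftrightarrow> successively (\<lambda>(x, s) (y, t). x = y \<longrightarrow> s = t) w"


section \<open>Torsion-free hyperbolic groups\<close>

definition torsion_free :: "('a, 'm) monoid_scheme \<Rightarrow> bool" where
  "torsion_free G \<longleftrightarrow>
     (\<forall>g \<in> carrier G. \<forall>n::nat. 0 < n \<and> g [^]\<^bsub>G\<^esub> n = \<one>\<^bsub>G\<^esub> \<longrightarrow> g = \<one>\<^bsub>G\<^esub>)"

definition word_length :: "('a, 'm) monoid_scheme \<Rightarrow> 'a set \<Rightarrow> 'a \<Rightarrow> nat" where
  "word_length G X g = (LEAST n. \<exists>w \<in> words X. length w = n \<and> word_value G w = g)"

text \<open>On \<open>carrier G\<close>, for a generating set \<open>X\<close>, this is the restriction to the vertices of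
  the path metric of the Cayley graph.\<close>

definition word_dist :: "('a, 'm) monoid_scheme \<Rightarrow> 'a set \<Rightarrow> 'a \<Rightarrow> 'a \<Rightarrow> real" where
  "word_dist G X x y = real (word_length G X (inv\<^bsub>G\<^esub> x \<otimes>\<^bsub>G\<^esub> y))"

definition Gromov_product :: "('a \<Rightarrow> 'a \<Rightarrow> real) \<Rightarrow> 'a \<Rightarrow> 'a \<Rightarrow> 'a \<Rightarrow> real" where
  "Gromov_product d w x y = (d x w + d y w - d x y) / 2"

definition Gromov_hyperbolic_on :: "'a set \<Rightarrow> ('a \<Rightarrow> 'a \<Rightarrow> real) \<Rightarrow> bool" where
  "Gromov_hyperbolic_on M d \<longleftrightarrow>
     (\<exists>\<delta>\<ge>0. \<forall>w\<in>M. \<forall>x\<in>M. \<forall>y\<in>M. \<forall>z\<in>M.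
        Gromov_product d w x z \<ge> min (Gromov_product d w x y) (Gromov_product d w y z) - \<delta>)"

definition hyperbolic_group :: "('a, 'm) monoid_scheme \<Rightarrow> bool" where
  "hyperbolic_group G \<longleftrightarrow>
     group G \<and>
     (\<exists>X. finite X \<and> X \<subseteq> carrier G \<and> generate G X = carrier G \<and>
          Gromov_hyperbolic_on (carrier G) (word_dist G X))"


section \<open>Free actions on \<open>\<Lambda>\<close>-trees\<close>

text \<open>The ordered abelian group \<open>\<Lambda>\<close> is an arbitrary type of class
  \<^class>\<open>linordered_ab_group_add\<close>. This class has no absolute value; \<open>max s t - min s t\<close> is
  the distance of \<open>s\<close> and \<open>t\<close> in \<open>\<Lambda>\<close>.\<close>

definition lambda_metric :: "'p set \<Rightarrow> ('p \<Rightarrow> 'p \<Rightarrow> 'l::linordered_ab_group_add) \<Rightarrow> bool" where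
  "lambda_metric X d \<longleftrightarrow>
     (\<forall>x\<in>X. \<forall>y\<in>X. 0 \<le> d x y \<and> (d x y = 0 \<longleftrightarrow> x = y) \<and> d x y = d y x) \<and>
     (\<forall>x\<in>X. \<forall>y\<in>X. \<forall>z\<in>X. d x z \<le> d x y + d y z)"

definition segment_between ::
    "'p set \<Rightarrow> ('p \<Rightarrow> 'p \<Rightarrow> 'l::linordered_ab_group_add) \<Rightarrow> 'p \<Rightarrow> 'p \<Rightarrow> 'p set \<Rightarrow> bool" where
  "segment_between X d x y S \<longleftrightarrow>
     S \<subseteq> X \<and>
     (\<exists>a b f. a \<le> b \<and> f ` {a..b} = S \<and> f a = x \<and> f b = y \<and>
        (\<forall>s\<in>{a..b}. \<forall>t\<in>{a..b}. d (f s) (f t) = max s t - min s t))"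

definition is_segment ::
    "'p set \<Rightarrow> ('p \<Rightarrow> 'p \<Rightarrow> 'l::linordered_ab_group_add) \<Rightarrow> 'p set \<Rightarrow> bool" where
  "is_segment X d S \<longleftrightarrow> (\<exists>x y. segment_between X d x y S)"

text \<open>Reversing the parametrization swaps the endpoints of a segment, so in the last two clauses
  it is enough to consider the second endpoint of one segment and the first one of the other,
  respectively the two first endpoints. Nonemptiness has to be required, since every group acts
  freely on the empty set.\<close>

definition lambda_tree :: "'p set \<Rightarrow> ('p \<Rightarrow> 'p \<Rightarrow> 'l::linordered_ab_group_add) \<Rightarrow> bool" where
  "lambda_tree X d \<longleftrightarrow>
     X \<noteq> {} \<and> lambda_metric X d \<and>
     (\<forall>x\<in>X. \<forall>y\<in>X. \<exists>S. segment_between X d x y S) \<and>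
     (\<forall>x y z S T. segment_between X d x y S \<and> segment_between X d y z T \<and> S \<inter> T = {y}
        \<longrightarrow> is_segment X d (S \<union> T)) \<and>
     (\<forall>x y z S T. segment_between X d x y S \<and> segment_between X d x z T
        \<longrightarrow> is_segment X d (S \<inter> T))"

definition isometric_action ::
    "('a, 'm) monoid_scheme \<Rightarrow> 'p set \<Rightarrow> ('p \<Rightarrow> 'p \<Rightarrow> 'l::linordered_ab_group_add)
      \<Rightarrow> ('a \<Rightarrow> 'p \<Rightarrow> 'p) \<Rightarrow> bool" where
  "isometric_action G X d \<phi> \<longleftrightarrow>
     group_action G X \<phi> \<and> (\<forall>g\<in>carrier G. \<forall>x\<in>X. \<forall>y\<in>X. d (\<phi> g x) (\<phi> g y) = d x y)"

text \<open>An inversion is an isometry without fixed points whose square has a fixed point.\<close>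

definition without_inversions ::
    "('a, 'm) monoid_scheme \<Rightarrow> 'p set \<Rightarrow> ('a \<Rightarrow> 'p \<Rightarrow> 'p) \<Rightarrow> bool" where
  "without_inversions G X \<phi> \<longleftrightarrow>
     \<not> (\<exists>g\<in>carrier G. (\<exists>x\<in>X. \<phi> g (\<phi> g x) = x) \<and> (\<forall>x\<in>X. \<phi> g x \<noteq> x))"

definition acts_freely_on_tree ::
    "('a, 'm) monoid_scheme \<Rightarrow> 'p set \<Rightarrow> ('p \<Rightarrow> 'p \<Rightarrow> 'l::linordered_ab_group_add)
      \<Rightarrow> ('a \<Rightarrow> 'p \<Rightarrow> 'p) \<Rightarrow> bool" where
  "acts_freely_on_tree G X d \<phi> \<longleftrightarrow>
     isometric_action G X d \<phi> \<and> without_inversions G X \<phi> \<and>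
     (\<forall>g\<in>carrier G. g \<noteq> \<one>\<^bsub>G\<^esub> \<longrightarrow> (\<forall>x\<in>X. \<phi> g x \<noteq> x))"


section \<open>Universally free groups\<close>

text \<open>Existential quantifiers and the remaining connectives are the usual abbreviations.\<close>

datatype group_term = Var nat | One | Inv group_term | Mult group_term group_term

datatype group_formula =
    Eq group_term group_term
  | Neg group_formula
  | Conj group_formula group_formula
  | Forall nat group_formula

primrec term_vars :: "group_term \<Rightarrow> nat set" where
  "term_vars (Var n) = {n}"
| "term_vars One = {}"
| "term_vars (Inv t) = term_vars t"
| "term_vars (Mult t u) = term_vars t \<union> term_vars u"

primrec free_vars :: "group_formula \<Rightarrow> nat set" where
  "free_vars (Eq t u) = term_vars t \<union> term_vars u"
| "free_vars (Neg p) = free_vars p"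
| "free_vars (Conj p q) = free_vars p \<union> free_vars q"
| "free_vars (Forall n p) = free_vars p - {n}"

primrec quantifier_free :: "group_formula \<Rightarrow> bool" where
  "quantifier_free (Eq t u) \<longleftrightarrow> True"
| "quantifier_free (Neg p) \<longleftrightarrow> quantifier_free p"
| "quantifier_free (Conj p q) \<longleftrightarrow> quantifier_free p \<and> quantifier_free q"
| "quantifier_free (Forall n p) \<longleftrightarrow> False"

primrec term_value :: "('a, 'm) monoid_scheme \<Rightarrow> (nat \<Rightarrow> 'a) \<Rightarrow> group_term \<Rightarrow> 'a" where
  "term_value G v (Var n) = v n"
| "term_value G v One = \<one>\<^bsub>G\<^esub>"
| "term_value G v (Inv t) = inv\<^bsub>G\<^esub> (term_value G v t)"
| "term_value G v (Mult t u) = term_value G v t \<otimes>\<^bsub>G\<^esub> term_value G v u"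

primrec satisfies :: "('a, 'm) monoid_scheme \<Rightarrow> (nat \<Rightarrow> 'a) \<Rightarrow> group_formula \<Rightarrow> bool" where
  "satisfies G v (Eq t u) \<longleftrightarrow> term_value G v t = term_value G v u"
| "satisfies G v (Neg p) \<longleftrightarrow> \<not> satisfies G v p"
| "satisfies G v (Conj p q) \<longleftrightarrow> satisfies G v p \<and> satisfies G v q"
| "satisfies G v (Forall n p) \<longleftrightarrow> (\<forall>a\<in>carrier G. satisfies G (v(n := a)) p)"

definition universal_sentence :: "group_formula \<Rightarrow> bool" where
  "universal_sentence p \<longleftrightarrow>
     free_vars p = {} \<and> (\<exists>ns q. quantifier_free q \<and> p = foldr Forall ns q)"

definition universal_theory :: "('a, 'm) monoid_scheme \<Rightarrow> group_formula set" where
  "universal_theory G =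
     {p. universal_sentence p \<and> (\<forall>v. range v \<subseteq> carrier G \<longrightarrow> satisfies G v p)}"

definition free_basis :: "('a, 'm) monoid_scheme \<Rightarrow> 'a set \<Rightarrow> bool" where
  "free_basis F X \<longleftrightarrow>
     X \<subseteq> carrier F \<and> bij_betw (word_value F) {w \<in> words X. reduced_word w} (carrier F)"

definition free_group :: "('a, 'm) monoid_scheme \<Rightarrow> bool" where
  "free_group F \<longleftrightarrow> group F \<and> (\<exists>X. free_basis F X)"

text \<open>A definition cannot quantify over types, so the type of the elements of the free group is
  a parameter. A theorem that is polymorphic in it covers all nonabelian free groups.\<close>

definition universally_free :: "'f itself \<Rightarrow> ('a, 'm) monoid_scheme \<Rightarrow> bool" where
  "universally_free _ G \<longleftrightarrow>
     group G \<and>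
     (\<exists>F :: 'f monoid. free_group F \<and> \<not> comm_group F \<and> universal_theory G = universal_theory F)"

end

theory Submission
  imports Defs "HOL-Library.Sublist"
begin

text \<open>A group is CSA as soon as centralizers of nontrivial elements are abelian and an element
  commuting with one of its conjugates \<open>y x y\<^sup>-\<^sup>1\<close> commutes with \<open>y\<close>.

  In a free action without inversions on a \<open>\<Lambda>\<close>-tree, every nontrivial \<open>x\<close> translates an axis
  that is isometric to a subset of \<open>\<Lambda>\<close>. Elements commuting with \<open>x\<close> act on the axis as translations,
  so the centralizer embeds in \<open>\<Lambda>\<close>; if \<open>x\<close> commutes with \<open>y x y\<^sup>-\<^sup>1\<close>, then \<open>y\<close> preserves the axis, and
  it cannot reverse it, since its square would fix a point.

  Both conditions are universal sentences, and a free group acts freely on itself with the word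
  metric, whose Gromov products are lengths of common prefixes.

  In a torsion-free hyperbolic group, a nontrivial \<open>x\<close> has a power \<open>u\<close> whose powers have lengths
  growing by more than \<open>2\<delta>\<close> in each step: otherwise arbitrarily many powers of \<open>x\<close> could be moved
  by a common conjugation into a fixed ball. The four-point inequality then shows that \<open>u\<close> generates
  a subgroup of finite index in its centralizer, which is abelian by a transfer argument. Finally
  \<open>y u\<^sup>a y\<^sup>-\<^sup>1 = u\<^sup>b\<close> forces \<open>\<bar>a\<bar> = \<bar>b\<bar>\<close> by comparing growth.\<close>

section \<open>A criterion for CSA-groups\<close>

definition commutant :: "('a, 'm) monoid_scheme \<Rightarrow> 'a \<Rightarrow> 'a set" where
  "commutant G x = {y \<in> carrier G. x \<otimes>\<^bsub>G\<^esub> y = y \<otimes>\<^bsub>G\<^esub> x}"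

lemma (in group) subgroup_commutant:
  assumes x: "x \<in> carrier G"
  shows "subgroup (commutant G x) G"
proof
  show "commutant G x \<subseteq> carrier G" "\<one> \<in> commutant G x" using x by (auto simp: commutant_def)
  show "a \<otimes> b \<in> commutant G x" if "a \<in> commutant G x" "b \<in> commutant G x" for a b
    using that x by (auto simp: commutant_def) (metis m_assoc)
  show "inv a \<in> commutant G x" if "a \<in> commutant G x" for a
    using that x by (auto simp: commutant_def) (metis inv_closed inv_solve_left inv_solve_right m_assoc m_closed)
qed

text \<open>If \<open>y\<close> conjugates \<open>k\<close> in \<open>M\<close> to a nontrivial
  \<open>h\<close> in \<open>M\<close>, then \<open>h\<close> commutes with its conjugate
  \<open>k = y \<otimes> h \<otimes> inv y\<close>, hence with \<open>y\<close>. The centralizer of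
  \<open>h\<close> is abelian and contains \<open>M\<close>, so maximality makes it equal to
  \<open>M\<close> and puts \<open>y\<close> into \<open>M\<close>.\<close>

lemma csa_groupI:
  fixes G (structure)
  assumes "group G"
    and centralizer: "\<And>x y z. \<lbrakk>x \<in> carrier G; y \<in> carrier G; z \<in> carrier G; x \<noteq> \<one>;
      x \<otimes> y = y \<otimes> x; x \<otimes> z = z \<otimes> x\<rbrakk> \<Longrightarrow> y \<otimes> z = z \<otimes> y"
    and conjugate: "\<And>x y. \<lbrakk>x \<in> carrier G; y \<in> carrier G; x \<noteq> \<one>;
      x \<otimes> (y \<otimes> x \<otimes> inv y) = (y \<otimes> x \<otimes> inv y) \<otimes> x\<rbrakk> \<Longrightarrow> x \<otimes> y = y \<otimes> x"
  shows "csa_group G"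
  unfolding csa_group_def conjugately_separated_def
proof (intro conjI allI impI ballI)
  interpret group G by fact
  show "group G" by fact
  fix M assume M: "maximal_abelian_subgroup G M"
  show sub: "subgroup M G"
    using M by (simp add: maximal_abelian_subgroup_def abelian_subgroup_def)
  have comm: "a \<otimes> b = b \<otimes> a" if "a \<in> M" "b \<in> M" for a b
    using comm_groupE(4)[of "G\<lparr>carrier := M\<rparr>" a b] M that
    by (simp add: maximal_abelian_subgroup_def abelian_subgroup_def)
  have MG: "a \<in> carrier G" if "a \<in> M" for a
    using sub that by (rule subgroup.mem_carrier)
  fix y assume y: "y \<in> carrier G - M"
  have "h = \<one>" if h: "h \<in> M" and k: "k \<in> M" and hk: "h = inv y \<otimes> k \<otimes> y" for h k
  proof (rule ccontr)
    assume "h \<noteq> \<one>"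
    have "y \<otimes> h \<otimes> inv y = (y \<otimes> inv y) \<otimes> k \<otimes> (y \<otimes> inv y)"
      using y MG[OF k] by (simp only: hk m_assoc m_closed inv_closed Diff_iff)
    then have kh: "k = y \<otimes> h \<otimes> inv y" using y MG[OF k] by simp
    have "h \<otimes> y = y \<otimes> h"
      by (rule conjugate) (use comm[OF h k] \<open>h \<noteq> \<one>\<close> MG[OF h] y in \<open>auto simp flip: kh\<close>)
    define C where "C = commutant G h"
    have C_comm: "a \<otimes> b = b \<otimes> a" if "a \<in> C" "b \<in> C" for a b
      using centralizer[of h a b] that MG[OF h] \<open>h \<noteq> \<one>\<close> by (auto simp: C_def commutant_def)
    have "subgroup C G" unfolding C_def by (rule subgroup_commutant[OF MG[OF h]])
    then have "abelian_subgroup G C"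
      unfolding abelian_subgroup_def
      by (auto intro!: group.group_comm_groupI subgroup.subgroup_is_group is_group C_comm)
    moreover have "M \<subseteq> C" using MG comm h by (auto simp: C_def commutant_def)
    ultimately have "C = M" using M by (auto simp: maximal_abelian_subgroup_def)
    moreover have "y \<in> C" using y \<open>h \<otimes> y = y \<otimes> h\<close> by (simp add: C_def commutant_def)
    ultimately show False using y by simp
  qed
  moreover have "\<one> \<in> M" "\<one> = inv y \<otimes> \<one> \<otimes> y" using y sub by (auto intro: subgroup.one_closed)
  ultimately show "M \<inter> (\<lambda>h. inv y \<otimes> h \<otimes> y) ` M = {\<one>}" by blast
qed

section \<open>Actions on \<open>\<Lambda>\<close>-trees\<close>

lemma double_le_cancel:
  fixes a b :: "'l::linordered_ab_group_add"
  assumes "a + a \<le> b + b"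
  shows "a \<le> b"
  using assms add_strict_mono[of b a b a] by (meson not_le)

text \<open>Here \<open>s\<close> is a signed displacement along an axis, while \<open>u\<close> and
  \<open>v\<close> are the distances covered by one and by two such steps. Equal signs give the
  claim; opposite signs make \<open>u + u + v\<close> vanish.\<close>

lemma double_eq_if_signed:
  fixes u v s :: "'l::linordered_ab_group_add"
  assumes "0 \<le> u" "0 \<le> v" "s = u \<or> s = - u" "s + s = v \<or> s + s = - v"
  shows "v = u + u"
proof -
  have "s + s = u + u \<or> s + s = - (u + u)" using assms(3) by auto
  then have "v = u + u \<or> v = - (u + u)" using assms(4) by (metis minus_minus)
  then have "v = u + u \<or> (u + u) + v = 0" by auto
  then show ?thesis
    using assms(1,2) add_nonneg_eq_0_iff[of "u + u" v] by auto
qed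

section \<open>Tree metrics and free actions\<close>

text \<open>A \<Lambda>-tree enters the argument only through its metric: 0-hyperbolicity in
  four-point form and the existence of medians. In this form a free group with its integer-valued
  word metric qualifies without any segments.\<close>

locale tree_metric =
  fixes X :: "'p set" and d :: "'p \<Rightarrow> 'p \<Rightarrow> 'l::linordered_ab_group_add"
  assumes nonempty: "X \<noteq> {}"
    and nonneg: "\<lbrakk>x \<in> X; y \<in> X\<rbrakk> \<Longrightarrow> 0 \<le> d x y"
    and zero_iff: "\<lbrakk>x \<in> X; y \<in> X\<rbrakk> \<Longrightarrow> d x y = 0 \<longleftrightarrow> x = y"
    and sym: "\<lbrakk>x \<in> X; y \<in> X\<rbrakk> \<Longrightarrow> d x y = d y x"
    and four_point: "\<lbrakk>x \<in> X; y \<in> X; z \<in> X; t \<in> X\<rbrakk>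
      \<Longrightarrow> d x z + d y t \<le> max (d x y + d z t) (d y z + d x t)"
    and median: "\<lbrakk>x \<in> X; y \<in> X; z \<in> X\<rbrakk>
      \<Longrightarrow> \<exists>m\<in>X. d x m + d m y = d x y \<and> d y m + d m z = d y z \<and> d x m + d m z = d x z"
begin

lemma triangle:
  assumes "x \<in> X" "y \<in> X" "z \<in> X"
  shows "d x z \<le> d x y + d y z"
  using four_point[of x y z y] assms zero_iff[of y y] sym[of z y] by (simp add: add.commute)

end

text \<open>The last assumption merges freeness with the absence of inversions: if the square of a
  nontrivial element fixed a point, the element would fix a point itself or be an inversion.\<close>

locale free_tree_action = group G + tree_metric X d
  for G :: "('a, 'm) monoid_scheme" (structure)
    and X :: "'p set" and d :: "'p \<Rightarrow> 'p \<Rightarrow> 'l::linordered_ab_group_add" +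
  fixes act :: "'a \<Rightarrow> 'p \<Rightarrow> 'p"  (infixr "\<bullet>" 75)
  assumes act_closed [simp]: "\<lbrakk>g \<in> carrier G; p \<in> X\<rbrakk> \<Longrightarrow> g \<bullet> p \<in> X"
    and act_mult: "\<lbrakk>g \<in> carrier G; h \<in> carrier G; p \<in> X\<rbrakk> \<Longrightarrow> (g \<otimes> h) \<bullet> p = g \<bullet> h \<bullet> p"
    and act_one [simp]: "p \<in> X \<Longrightarrow> \<one> \<bullet> p = p"
    and isometry [simp]: "\<lbrakk>g \<in> carrier G; p \<in> X; q \<in> X\<rbrakk> \<Longrightarrow> d (g \<bullet> p) (g \<bullet> q) = d p q"
    and free: "\<lbrakk>g \<in> carrier G; g \<noteq> \<one>; p \<in> X\<rbrakk> \<Longrightarrow> g \<bullet> g \<bullet> p \<noteq> p"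
begin

lemma eq_if_act_eq:
  assumes "g \<in> carrier G" "h \<in> carrier G" "p \<in> X" "g \<bullet> p = h \<bullet> p"
  shows "g = h"
proof -
  have "(inv h \<otimes> g) \<bullet> p = (inv h \<otimes> h) \<bullet> p"
    using assms by (simp only: act_mult inv_closed)
  then have "(inv h \<otimes> g) \<bullet> p = p" using assms by simp
  then have "inv h \<otimes> g = \<one>"
    using free[of "inv h \<otimes> g" p] assms by auto
  then show ?thesis using assms by (metis inv_closed inv_equality inv_inv)
qed

section \<open>Axes of nontrivial elements\<close>

text \<open>The translation axis of \<open>x\<close>, described by the absence of backtracking at
  \<open>x \<bullet> q\<close>, so that no translation length has to be known beforehand.\<close>

definition axis :: "'a \<Rightarrow> 'p set" where
  "axis x = {q \<in> X. d q (x \<bullet> x \<bullet> q) = d q (x \<bullet> q) + d q (x \<bullet> q)}"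

text \<open>On the axis this is the linear order in the direction of translation: pushing
  \<open>b\<close> forward moves it away from \<open>a\<close> by a full translation length exactly
  if \<open>b\<close> is not behind \<open>a\<close>.\<close>

definition before :: "'a \<Rightarrow> 'p \<Rightarrow> 'p \<Rightarrow> bool" where
  "before x a b \<longleftrightarrow> d a (x \<bullet> b) = d a b + d a (x \<bullet> a)"

text \<open>For points on the axis, the difference of their coordinates in \<Lambda>.\<close>

definition signed :: "'a \<Rightarrow> 'p \<Rightarrow> 'p \<Rightarrow> 'l" where
  "signed x a b = (if before x a b then d a b else - d a b)"

text \<open>The witness is \<open>q\<close> with \<open>x \<bullet> q\<close> the median of \<open>p\<close>, \<open>x \<bullet> p\<close> and \<open>x \<bullet> x \<bullet> p\<close>. If the
  translates of \<open>[p, x \<bullet> p]\<close> overlapped in more than half of it, \<open>q\<close> would be fixed by the square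
  of \<open>x\<close>.\<close>

lemma axis_nonempty:
  assumes x: "x \<in> carrier G" "x \<noteq> \<one>"
  obtains q where "q \<in> axis x"
proof -
  obtain p where p: "p \<in> X" using nonempty by auto
  define L where "L = d p (x \<bullet> p)"
  obtain m where m: "m \<in> X" "d p m + d m (x \<bullet> p) = L"
      "d (x \<bullet> p) m + d m (x \<bullet> x \<bullet> p) = L" "d p m + d m (x \<bullet> x \<bullet> p) = d p (x \<bullet> x \<bullet> p)"
    using median[of p "x \<bullet> p" "x \<bullet> x \<bullet> p"] p x by (auto simp: L_def)
  define q where "q = inv x \<bullet> m"
  have q: "q \<in> X" "x \<bullet> q = m"
    using x m by (auto simp: q_def simp flip: act_mult)
  define v where "v = d m (x \<bullet> p)"
  note D = x p q m(1)
  have mxp: "d m (x \<bullet> p) = v" and mp: "d m p = L - v" and mxxp: "d m (x \<bullet> x \<bullet> p) = L - v"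
    using m sym[of m "x \<bullet> p"] sym[of m p] D by (auto simp: v_def algebra_simps)
  have qp: "d q p = v" using isometry[of x q p] D mxp by simp
  have qxp: "d q (x \<bullet> p) = L - v" using isometry[of x q "x \<bullet> p"] D mxxp by simp
  have xmxp: "d (x \<bullet> m) (x \<bullet> p) = L - v" and xmxxp: "d (x \<bullet> m) (x \<bullet> x \<bullet> p) = v"
    using isometry[of x m p] isometry[of x m "x \<bullet> p"] D mxp mp by auto
  have qm: "d q m + L \<le> max (v + v) (L - v + (L - v))"
    using four_point[of q p m "x \<bullet> p"] D qp mxp mp qxp sym[of p m] by (simp add: L_def)
  have "v + v < L"
  proof (rule ccontr)
    assume "\<not> v + v < L"
    then have Lv: "L \<le> v + v" by simp
    have "L - v + (L - v) \<le> v + v"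
      using add_mono[OF Lv Lv] by (simp add: algebra_simps)
    then have qm': "d q m \<le> v + v - L" using qm by (simp add: algebra_simps)
    have "d (x \<bullet> m) m + L \<le> max (L - v + (L - v)) (v + v)"
      using four_point[of "x \<bullet> m" "x \<bullet> p" m "x \<bullet> x \<bullet> p"] D xmxp xmxxp mxp mxxp sym[of "x \<bullet> p" m]
      by (simp add: L_def)
    then have "d (x \<bullet> m) m \<le> v + v - L" 
      using \<open>L - v + (L - v) \<le> v + v\<close> by (simp add: algebra_simps)
    then have "max (d (x \<bullet> m) m + (L - v)) (d q m + (L - v)) \<le> v"
      using qm' by (simp add: algebra_simps)
    moreover have "d (x \<bullet> m) q + v \<le> max (d (x \<bullet> m) m + (L - v)) (d q m + (L - v))"
      using four_point[of "x \<bullet> m" m q "x \<bullet> p"] D xmxp qxp mxp sym[of m q] by simp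
    ultimately have "d (x \<bullet> m) q + v \<le> v" by (rule order_trans[rotated])
    then have "x \<bullet> x \<bullet> q = q"
      using nonneg[of "x \<bullet> m" q] zero_iff[of "x \<bullet> m" q] D by simp
    then show False using free x D by blast
  qed
  then have "v + v + (v + v) \<le> L + L" by (intro add_mono) auto
  then have "v + v \<le> L - v + (L - v)" by (simp add: algebra_simps)
  then have qm': "d q m \<le> L - v - v" using qm by (simp add: algebra_simps)
  \<comment> \<open>The path through \<open>p\<close>, \<open>q\<close>,
    \<open>x \<bullet> m\<close>, \<open>x \<bullet> x \<bullet> p\<close> bounds
    \<open>d q (x \<bullet> m)\<close> from below by twice \<open>L - v - v\<close>, the upper bound
    for \<open>d q m\<close>. So the triangle inequality at \<open>m\<close> is an equality.\<close>
  have "d p (x \<bullet> x \<bullet> p) = L - v + (L - v)" using m mp mxxp sym[of m p] D by simp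
  moreover have "d p (x \<bullet> x \<bullet> p) \<le> d p q + d q (x \<bullet> x \<bullet> p)"
    "d q (x \<bullet> x \<bullet> p) \<le> d q (x \<bullet> m) + d (x \<bullet> m) (x \<bullet> x \<bullet> p)"
    using triangle[of p q "x \<bullet> x \<bullet> p"] triangle[of q "x \<bullet> m" "x \<bullet> x \<bullet> p"] D by auto
  ultimately have "L - v + (L - v) \<le> v + (d q (x \<bullet> m) + v)"
    using qp xmxxp sym[of p q] D by (metis (no_types, lifting) add_left_mono order_trans)
  then have ge: "(L - v - v) + (L - v - v) \<le> d q (x \<bullet> m)" by (simp add: algebra_simps)
  have "d q (x \<bullet> m) \<le> d q m + d m (x \<bullet> m)" using D by (intro triangle) auto
  moreover have "d m (x \<bullet> m) = d q m" using isometry[of x q m] D by simp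
  ultimately have "d q (x \<bullet> m) = d q m + d q m"
    using ge add_mono[OF qm' qm'] by (metis order.antisym order.trans)
  then show thesis using that[of q] q by (simp add: axis_def)
qed

lemma axis_in_X: "q \<in> axis x \<Longrightarrow> q \<in> X"
  by (simp add: axis_def)

lemma displacement_pos:
  assumes "x \<in> carrier G" "x \<noteq> \<one>" "q \<in> X"
  shows "0 < d q (x \<bullet> q)"
  using nonneg[of q "x \<bullet> q"] zero_iff[of q "x \<bullet> q"] assms free[of x q] by force

lemma act_in_axis:
  assumes "x \<in> carrier G" "h \<in> carrier G" "x \<otimes> h = h \<otimes> x" "q \<in> axis x"
  shows "h \<bullet> q \<in> axis x"
proof -
  have "x \<bullet> h \<bullet> p = h \<bullet> x \<bullet> p" if "p \<in> X" for p
    using assms that by (simp flip: act_mult)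
  then show ?thesis using assms by (simp add: axis_def)
qed

text \<open>Any point \<open>b\<close> projects to one side of \<open>a\<close> on the axis. As
  \<open>d a (x \<bullet> x \<bullet> a)\<close> is twice the displacement, the four-point
  inequality for \<open>a\<close>, \<open>x \<bullet> a\<close>,
  \<open>x \<bullet> x \<bullet> a\<close>, \<open>x \<bullet> b\<close> forces equality in one of
  two triangle inequalities.\<close>

lemma axis_step:
  assumes "x \<in> carrier G" "a \<in> axis x" "b \<in> X"
  shows "d b (x \<bullet> a) = d b a + d a (x \<bullet> a) \<or> d a (x \<bullet> b) = d a b + d a (x \<bullet> a)"
proof -
  note D = assms(1,3) axis_in_X[OF assms(2)]
  define t where "t = d a (x \<bullet> a)"
  have "(t + t) + d a b \<le> max (t + d (x \<bullet> a) b) (t + d a (x \<bullet> b))"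
    using four_point[of a "x \<bullet> a" "x \<bullet> x \<bullet> a" "x \<bullet> b"] assms D by (simp add: axis_def t_def)
  then have "t + d a b \<le> d (x \<bullet> a) b \<or> t + d a b \<le> d a (x \<bullet> b)"
    by (auto simp: le_max_iff_disj add.assoc)
  moreover have "d (x \<bullet> a) b \<le> t + d a b" "d a (x \<bullet> b) \<le> t + d a b"
    using triangle[of "x \<bullet> a" a b] triangle[of a "x \<bullet> a" "x \<bullet> b"] D sym[of a "x \<bullet> a"] by (auto simp: t_def)
  ultimately show ?thesis
    using D sym[of "x \<bullet> a" b] sym[of a b] by (auto simp: t_def add.commute)
qed

text \<open>If \<open>a\<close> is ahead of \<open>b\<close>, the distance from \<open>b\<close> to
  \<open>x \<bullet> x \<bullet> a\<close> exceeds that to \<open>x \<bullet> a\<close> by the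
  displacement of \<open>a\<close> and also by that of \<open>b\<close>. Both follow from
  \<open>axis_step\<close>, whose other alternatives contradict positivity.\<close>

lemma axis_displacement_eq:
  assumes x: "x \<in> carrier G" "x \<noteq> \<one>" and ab: "a \<in> axis x" "b \<in> axis x"
  shows "d a (x \<bullet> a) = d b (x \<bullet> b)"
proof -
  have key: "d a (x \<bullet> a) = d b (x \<bullet> b)"
    if "d b (x \<bullet> a) = d b a + t" "0 < t" and ab: "a \<in> axis x" "b \<in> axis x" for a b t
  proof -
    note D = x ab[THEN axis_in_X]
    have "0 < d a (x \<bullet> a)" "0 < d b (x \<bullet> b)" using displacement_pos D by auto
    then have pos: "0 < t + d a (x \<bullet> a)" "0 < t + d b (x \<bullet> b)"
      using \<open>0 < t\<close> by (simp_all add: add_pos_pos)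
    have xa: "x \<bullet> a \<in> axis x" using act_in_axis x ab by simp
    have "d b (x \<bullet> x \<bullet> a) = d b (x \<bullet> a) + d a (x \<bullet> a)"
      using axis_step[of x "x \<bullet> a" b] that(1) xa x D pos sym[of "x \<bullet> a" b] sym[of a b]
      by (auto simp: add.assoc)
    moreover have "d b (x \<bullet> x \<bullet> a) = d b (x \<bullet> a) + d b (x \<bullet> b)"
      using axis_step[of x b "x \<bullet> a"] that(1) ab x D pos sym[of "x \<bullet> a" b] sym[of a b]
      by (auto simp: add.assoc)
    ultimately show ?thesis by simp
  qed
  note D = x ab[THEN axis_in_X]
  consider "d b (x \<bullet> a) = d b a + d a (x \<bullet> a)" | "d a (x \<bullet> b) = d a b + d a (x \<bullet> a)"
    using axis_step[of x a b] ab D by blast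
  then show ?thesis
    using key displacement_pos D ab by cases metis+
qed

lemma before_total:
  assumes "x \<in> carrier G" "x \<noteq> \<one>" "a \<in> axis x" "b \<in> axis x"
  shows "before x a b \<or> before x b a"
  using axis_step[OF assms(1,3) axis_in_X[OF assms(4)]] axis_displacement_eq[OF assms]
  unfolding before_def by auto

text \<open>With \<open>a\<close> and \<open>b\<close> each ahead of the other, the diagonals
  \<open>d a (x \<bullet> b)\<close> and \<open>d b (x \<bullet> a)\<close> add up to
  \<open>e + e + t + t\<close>, which exceeds both other sums of the four-point inequality unless
  \<open>e\<close> vanishes.\<close>

lemma before_antisym:
  assumes x: "x \<in> carrier G" "x \<noteq> \<one>" and ab: "a \<in> axis x" "b \<in> axis x"
    and before: "before x a b" "before x b a"
  shows "a = b"
proof -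
  note D = x ab[THEN axis_in_X]
  define e t where "e = d a b" and "t = d a (x \<bullet> a)"
  have t: "d b (x \<bullet> b) = t" "0 < t"
    using axis_displacement_eq[OF x ab] displacement_pos D by (auto simp: t_def)
  have "(e + e) + (t + t) \<le> max (e + e) (t + t)"
    using four_point[of a b "x \<bullet> b" "x \<bullet> a"] D before t sym[of "x \<bullet> b" "x \<bullet> a"] sym[of a b]
    by (simp add: before_def ac_simps flip: e_def t_def)
  moreover have "0 < t + t" using t by (simp add: add_pos_pos)
  ultimately have "e + e \<le> 0" by (auto simp: le_max_iff_disj)
  then have "e \<le> 0" using double_le_cancel[of e 0] by simp
  then show ?thesis using nonneg[of a b] zero_iff[of a b] D by (simp add: e_def)
qed

text \<open>Measuring to \<open>x \<bullet> b\<close> and \<open>x \<bullet> c\<close> instead of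
  \<open>b\<close> and \<open>c\<close> adds two translation lengths to the left side of the
  four-point inequality. This surplus excludes the first alternative of the maximum.\<close>

lemma before_trans:
  assumes x: "x \<in> carrier G" "x \<noteq> \<one>" and abc: "a \<in> axis x" "b \<in> axis x" "c \<in> axis x"
    and before: "before x a b" "before x b c"
  shows "before x a c" and "d a c = d a b + d b c"
proof -
  note D = x abc[THEN axis_in_X]
  define t u v where "t = d a (x \<bullet> a)" and "u = d a b" and "v = d b c"
  have t: "d b (x \<bullet> b) = t" "d c (x \<bullet> c) = t" "0 < t"
    using axis_displacement_eq[OF x abc(1,2)] axis_displacement_eq[OF x abc(1,3)] displacement_pos D
    by (simp_all add: t_def)
  have "d a (x \<bullet> b) = u + t" "d b (x \<bullet> c) = v + t" "d (x \<bullet> b) (x \<bullet> c) = v"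
    using before D t by (auto simp: before_def t_def u_def v_def)
  then have "(u + t) + (v + t) \<le> max (u + v) (t + d a (x \<bullet> c))"
    using four_point[of a b "x \<bullet> b" "x \<bullet> c"] D t by (simp add: u_def)
  moreover have "0 < t + t" using t by (simp add: add_pos_pos)
  then have "\<not> (u + t) + (v + t) \<le> u + v" by (simp add: algebra_simps)
  ultimately have "(u + t) + (v + t) \<le> t + d a (x \<bullet> c)" by (simp add: le_max_iff_disj)
  then have ge: "u + v + t \<le> d a (x \<bullet> c)" by (simp add: ac_simps)
  have le: "d a (x \<bullet> c) \<le> d a c + t" and le': "d a c \<le> u + v"
    using triangle[of a c "x \<bullet> c"] triangle[of a b c] D t by (auto simp: u_def v_def)
  have "u + v \<le> d a c" using order.trans[OF ge le] by simp
  with le' have eq: "d a c = u + v" by (rule order.antisym)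
  then show "d a c = d a b + d b c" by (simp add: u_def v_def)
  show "before x a c"
    unfolding before_def using ge le by (intro order.antisym) (simp_all add: eq t_def)
qed

lemma signed_minus:
  assumes "x \<in> carrier G" "x \<noteq> \<one>" "a \<in> axis x" "b \<in> axis x"
  shows "signed x b a = - signed x a b"
  using before_total[OF assms] before_antisym[OF assms] sym[of a b] assms axis_in_X zero_iff[of a a]
  by (auto simp: signed_def)

lemma signed_add:
  assumes x: "x \<in> carrier G" "x \<noteq> \<one>" and abc: "a \<in> axis x" "b \<in> axis x" "c \<in> axis x"
  shows "signed x a b + signed x b c = signed x a c"
proof -
  have ordered: "signed x a b + signed x b c = signed x a c"
    if "before x a b" "before x b c" "a \<in> axis x" "b \<in> axis x" "c \<in> axis x" for a b c
    using before_trans[OF x that(3-5,1,2)] that by (simp add: signed_def)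
  note total = before_total[OF x abc(1,2)] before_total[OF x abc(2,3)] before_total[OF x abc(1,3)]
  \<comment> \<open>Whatever the three comparisons are, two of them form a chain through all three
    points, and \<open>ordered\<close> applies to that chain.\<close>
  have "signed x a b + signed x b c = signed x a c \<or> signed x b a + signed x a c = signed x b c
      \<or> signed x a c + signed x c b = signed x a b \<or> signed x c a + signed x a b = signed x c b
      \<or> signed x b c + signed x c a = signed x b a \<or> signed x c b + signed x b a = signed x c a"
    using total ordered abc by blast
  then show ?thesis
    using signed_minus[OF x abc(1,2)] signed_minus[OF x abc(2,3)] signed_minus[OF x abc(1,3)]
    by (elim disjE) (auto simp: algebra_simps)
qed

lemma signed_eq_0:
  assumes "a \<in> X" "b \<in> X" "signed x a b = 0"
  shows "a = b"
  using assms zero_iff[of a b] by (auto simp: signed_def split: if_splits)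

lemma signed_act:
  assumes "x \<in> carrier G" "h \<in> carrier G" "x \<otimes> h = h \<otimes> x" "a \<in> X" "b \<in> X"
  shows "signed x (h \<bullet> a) (h \<bullet> b) = signed x a b"
proof -
  have "x \<bullet> h \<bullet> p = h \<bullet> x \<bullet> p" if "p \<in> X" for p
    using assms that by (simp flip: act_mult)
  then show ?thesis using assms by (simp add: signed_def before_def)
qed

text \<open>Translations of \<Lambda> commute, so \<open>h \<bullet> k \<bullet> q\<close> and
  \<open>k \<bullet> h \<bullet> q\<close> have the same coordinate, and freeness turns equality of
  points into equality of elements. Invariance is required for two pairs only, so that the lemma
  also serves for an element not yet known to commute with \<open>x\<close>.\<close>

lemma commute_if_signed_invariant:
  assumes x: "x \<in> carrier G" "x \<noteq> \<one>" and hk: "h \<in> carrier G" "k \<in> carrier G"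
    and q: "q \<in> axis x" "h \<bullet> q \<in> axis x" "k \<bullet> q \<in> axis x" "h \<bullet> k \<bullet> q \<in> axis x" "k \<bullet> h \<bullet> q \<in> axis x"
    and inv: "signed x (h \<bullet> q) (h \<bullet> k \<bullet> q) = signed x q (k \<bullet> q)"
      "signed x (k \<bullet> q) (k \<bullet> h \<bullet> q) = signed x q (h \<bullet> q)"
  shows "h \<otimes> k = k \<otimes> h"
proof -
  note s = signed_add[OF x]
  have "signed x (h \<bullet> k \<bullet> q) (k \<bullet> h \<bullet> q) = signed x (h \<bullet> k \<bullet> q) q + signed x q (k \<bullet> h \<bullet> q)"
    using s q by simp
  also have "\<dots> = signed x q (k \<bullet> h \<bullet> q) - signed x q (h \<bullet> k \<bullet> q)"
    using signed_minus[OF x q(1,4)] by simp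
  also have "\<dots> = 0"
    using s[OF q(1,2,4)] s[OF q(1,3,5)] inv by (simp add: ac_simps)
  finally have "h \<bullet> k \<bullet> q = k \<bullet> h \<bullet> q"
    using signed_eq_0 q axis_in_X by blast
  then show ?thesis
    using eq_if_act_eq[of "h \<otimes> k" "k \<otimes> h" q] hk q axis_in_X by (simp add: act_mult)
qed

lemma centralizer_commute:
  assumes x: "x \<in> carrier G" "x \<noteq> \<one>" and hk: "h \<in> carrier G" "k \<in> carrier G"
    and comm: "x \<otimes> h = h \<otimes> x" "x \<otimes> k = k \<otimes> x"
  shows "h \<otimes> k = k \<otimes> h"
proof -
  obtain q where q: "q \<in> axis x" using axis_nonempty[OF x] .
  show ?thesis
    by (rule commute_if_signed_invariant[OF x hk q])
      (use x hk comm q act_in_axis signed_act axis_in_X in auto)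
qed

text \<open>\<open>h\<close> shifts coordinates on the axis of \<open>x\<close> by a constant, so
  \<open>h \<bullet> h \<bullet> q\<close> is twice as far from \<open>q\<close> as
  \<open>h \<bullet> q\<close>. Used in both directions, this gives commuting elements the same
  axis.\<close>

lemma axis_subset_axis:
  assumes x: "x \<in> carrier G" "x \<noteq> \<one>" and h: "h \<in> carrier G" "h \<noteq> \<one>" and comm: "x \<otimes> h = h \<otimes> x"
  shows "axis x \<subseteq> axis h"
proof
  fix q assume q: "q \<in> axis x"
  note hq = act_in_axis[OF x(1) h(1) comm]
  have X: "q \<in> X" "h \<bullet> q \<in> X" "h \<bullet> h \<bullet> q \<in> X" using axis_in_X[OF q] h by auto
  have "signed x q (h \<bullet> q) + signed x q (h \<bullet> q) = signed x q (h \<bullet> h \<bullet> q)"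
    using signed_add[OF x q hq[OF q] hq[OF hq[OF q]]] signed_act[OF x(1) h(1) comm X(1,2)] by simp
  then have "d q (h \<bullet> h \<bullet> q) = d q (h \<bullet> q) + d q (h \<bullet> q)"
    by (intro double_eq_if_signed[of _ _ "signed x q (h \<bullet> q)"] nonneg X) (simp_all add: signed_def)
  then show "q \<in> axis h" using X by (simp add: axis_def)
qed

text \<open>\<open>y\<close> carries the axis of \<open>x\<close> to that of \<open>z\<close>, which
  is the same axis because \<open>z\<close> commutes with \<open>x\<close>. The sign of the shift
  \<open>s\<close> of \<open>z\<close> decides whether \<open>y\<close> keeps or reverses the order
  on it.\<close>

lemma conjugate_commute:
  assumes x: "x \<in> carrier G" "x \<noteq> \<one>" and y: "y \<in> carrier G"
    and comm: "x \<otimes> (y \<otimes> x \<otimes> inv y) = (y \<otimes> x \<otimes> inv y) \<otimes> x"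
  shows "x \<otimes> y = y \<otimes> x"
proof -
  define z where "z = y \<otimes> x \<otimes> inv y"
  have zy: "z \<otimes> y = y \<otimes> x" and z: "z \<in> carrier G"
    using x y by (auto simp: z_def m_assoc)
  have z_not_one: "z \<noteq> \<one>"
  proof
    assume "z = \<one>"
    then have "y \<otimes> x = y \<otimes> \<one>" using zy y by simp
    then show False using x y by simp
  qed
  note zc = z z_not_one
  have xz: "x \<otimes> z = z \<otimes> x" using comm by (simp add: z_def)
  have axis_eq: "axis z = axis x"
    using axis_subset_axis[OF x zc xz] axis_subset_axis[OF zc x xz[symmetric]] by blast
  have z_act: "z \<bullet> y \<bullet> p = y \<bullet> x \<bullet> p" if "p \<in> X" for p
    using zy x y z that by (simp flip: act_mult)
  have y_axis: "y \<bullet> p \<in> axis x" if "p \<in> axis x" for p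
  proof -
    have "y \<bullet> p \<in> axis z" using that x y z_act by (simp add: axis_def)
    then show ?thesis by (simp add: axis_eq)
  qed
  have y_before: "before z (y \<bullet> a) (y \<bullet> b) \<longleftrightarrow> before x a b" if "a \<in> X" "b \<in> X" for a b
    using that x y by (simp add: before_def z_act)
  obtain q where q: "q \<in> axis x" using axis_nonempty[OF x] .
  have xq: "x \<bullet> q \<in> axis x" using act_in_axis[OF x(1) x(1)] q by simp
  note za = act_in_axis[OF x(1) z xz]
  define s where "s = signed x q (z \<bullet> q)"
  have z_shift: "signed x a (z \<bullet> a) = s" if a: "a \<in> axis x" for a
  proof -
    have "signed x q a + signed x a (z \<bullet> a) = signed x q (z \<bullet> q) + signed x (z \<bullet> q) (z \<bullet> a)"
      using signed_add[OF x] q a za by simp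
    then show ?thesis using signed_act[OF x(1) z xz] q a axis_in_X by (simp add: s_def)
  qed
  have dist_eq: "d a b = r"
    if "signed x a b = r \<or> signed x a b = - r" "0 < r" "a \<in> X" "b \<in> X" for a b r
    using that nonneg[of a b] by (auto simp: signed_def split: if_splits)
  have signed_z: "signed x a (z \<bullet> b) = signed x a b + s" if "a \<in> axis x" "b \<in> axis x" for a b
    using signed_add[OF x that za[OF that(2)]] z_shift[OF that(2)] by simp
  have refl: "before x a a" if "a \<in> axis x" for a
    using that axis_in_X zero_iff by (simp add: before_def)
  note total = before_total[OF x]
  have antisym: "a = b" if "before z a b" "before z b a" "a \<in> axis x" "b \<in> axis x" for a b
    using before_antisym[OF zc] that axis_eq by blast
  show ?thesis
  proof (cases "before x q (z \<bullet> q)")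
    case True
    then have s: "0 < s" using displacement_pos[OF zc] q axis_in_X by (simp add: s_def signed_def)
    have before_z: "before z a b" if "before x a b" and ab: "a \<in> axis x" "b \<in> axis x" for a b
    proof -
      have X: "a \<in> X" "b \<in> X" "z \<bullet> a \<in> X" "z \<bullet> b \<in> X" using ab axis_in_X z by auto
      have "signed x a (z \<bullet> b) = d a b + s" "signed x a (z \<bullet> a) = s"
        using signed_z that z_shift by (auto simp: signed_def)
      moreover have "0 < d a b + s" using s nonneg[of a b] X by (simp add: add_nonneg_pos)
      ultimately have "d a (z \<bullet> b) = d a b + s" "d a (z \<bullet> a) = s"
        using s X by (auto intro!: dist_eq)
      then show ?thesis by (simp add: before_def)
    qed
    \<comment> \<open>One implication suffices, as the order of \<open>x\<close> is total and that
      of \<open>z\<close> antisymmetric.\<close>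
    have "before z a b \<longleftrightarrow> before x a b" if "a \<in> axis x" "b \<in> axis x" for a b
      using before_z[OF _ that] before_z[OF _ that(2,1)] total[OF that] antisym[OF _ _ that] refl[OF that(1)]
      by blast
    then have "signed x (y \<bullet> a) (y \<bullet> b) = signed x a b" if "a \<in> axis x" "b \<in> axis x" for a b
      using that y_before[of a b] y_axis y axis_in_X by (simp add: signed_def)
    then show ?thesis
      using x y q xq y_axis signed_act[OF x(1) x(1)] act_in_axis[OF x(1) x(1)] axis_in_X
      by (intro commute_if_signed_invariant[OF x x(1) y q]) auto
  next
    case False
    then have s: "s < 0" using displacement_pos[OF zc] q axis_in_X by (simp add: s_def signed_def)
    have before_z: "before z b a" if "before x a b" and ab: "a \<in> axis x" "b \<in> axis x" for a b
    proof -
      have X: "a \<in> X" "b \<in> X" "z \<bullet> a \<in> X" "z \<bullet> b \<in> X" using ab axis_in_X z by auto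
      have "signed x b a = - d b a"
        using signed_minus[OF x ab] that(1) sym[OF X(1,2)] by (simp add: signed_def)
      then have "signed x b (z \<bullet> a) = - (d b a - s)" using signed_z[OF ab(2,1)] by simp
      moreover have "0 < d b a - s" using s nonneg[OF X(2,1)] add_nonneg_pos[of "d b a" "- s"] by simp
      ultimately have "d b (z \<bullet> a) = d b a - s" using X by (intro dist_eq disjI2)
      moreover have "d b (z \<bullet> b) = - s"
        using s X z_shift[OF ab(2)] by (intro dist_eq disjI2) simp_all
      ultimately show ?thesis by (simp add: before_def)
    qed
    have before_z_iff: "before z b a \<longleftrightarrow> before x a b" if "a \<in> axis x" "b \<in> axis x" for a b
      using before_z[OF _ that] before_z[OF _ that(2,1)] total[OF that] antisym[OF _ _ that] refl[OF that(1)]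
      by blast
    \<comment> \<open>A reversing \<open>y\<close> maps the step from \<open>q\<close> to
      \<open>y \<bullet> q\<close> to a step of the same length back, so its square fixes
      \<open>q\<close>.\<close>
    have "before x (y \<bullet> y \<bullet> q) (y \<bullet> q) \<longleftrightarrow> before x q (y \<bullet> q)"
      using before_z_iff[OF y_axis[OF y_axis[OF q]] y_axis[OF q]] y_before[of q "y \<bullet> q"] y axis_in_X[OF q]
      by simp
    then have "signed x (y \<bullet> y \<bullet> q) (y \<bullet> q) = signed x q (y \<bullet> q)"
      using y axis_in_X[OF q] sym[of "y \<bullet> q" q] by (simp add: signed_def)
    then have "signed x q (y \<bullet> y \<bullet> q) = 0"
      using signed_add[OF x q y_axis[OF q] y_axis[OF y_axis[OF q]]]
        signed_minus[OF x y_axis[OF y_axis[OF q]] y_axis[OF q]] by simp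
    then have "y \<bullet> y \<bullet> q = q"
      using signed_eq_0[of q "y \<bullet> y \<bullet> q" x] axis_in_X[OF q] y by simp
    then have "y = \<one>" using free[OF y _ axis_in_X[OF q]] by blast
    then show ?thesis using x by simp
  qed
qed

lemma csa_group: "csa_group G"
  by (rule csa_groupI[OF is_group centralizer_commute conjugate_commute])

end

section \<open>From segments in \<Lambda>-trees to medians and the four-point inequality\<close>

lemma segment_between_param:
  assumes "segment_between X d x y S"
  obtains a b f where "a \<le> b" "f ` {a..b} = S" "f a = x" "f b = y"
    "\<And>s t. \<lbrakk>s \<in> {a..b}; t \<in> {a..b}\<rbrakk> \<Longrightarrow> d (f s) (f t) = max s t - min s t"
    "\<And>t. t \<in> {a..b} \<Longrightarrow> d x (f t) = t - a"
proof -
  obtain a b f where f: "a \<le> b" "f ` {a..b} = S" "f a = x" "f b = y"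
    "\<forall>s\<in>{a..b}. \<forall>t\<in>{a..b}. d (f s) (f t) = max s t - min s t"
    using assms unfolding segment_between_def by blast
  moreover have "d x (f t) = t - a" if "t \<in> {a..b}" for t
    using f(1,5) that by (auto simp: min_def max_def simp flip: f(3))
  ultimately show thesis using that by blast
qed

lemma segment_between_subset: "segment_between X d x y S \<Longrightarrow> S \<subseteq> X"
  by (simp add: segment_between_def)

lemma segment_between_ends:
  assumes "segment_between X d x y S"
  shows "x \<in> S" "y \<in> S"
  using assms by (auto elim!: segment_between_param)

lemma segment_between_dist:
  assumes S: "segment_between X d x y S" and "p \<in> S" "q \<in> S"
  shows "d p q = max (d x p) (d x q) - min (d x p) (d x q)"
proof -
  obtain a b f where f: "a \<le> b" "f ` {a..b} = S" "f a = x" "f b = y"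
    "\<And>s t. \<lbrakk>s \<in> {a..b}; t \<in> {a..b}\<rbrakk> \<Longrightarrow> d (f s) (f t) = max s t - min s t"
    "\<And>t. t \<in> {a..b} \<Longrightarrow> d x (f t) = t - a"
    using segment_between_param[OF S] by blast
  then obtain s t where "s \<in> {a..b}" "t \<in> {a..b}" "p = f s" "q = f t" using assms by auto
  then show ?thesis using f(5,6) by (auto simp: max_def min_def)
qed

lemma segment_between_dist_le:
  assumes S: "segment_between X d x y S" and "p \<in> S"
  shows "0 \<le> d x p" "d x p \<le> d x y"
proof -
  obtain a b f where f: "a \<le> b" "f ` {a..b} = S" "f b = y"
    "\<And>t. t \<in> {a..b} \<Longrightarrow> d x (f t) = t - a"
    using segment_between_param[OF S] by metis
  then obtain t where "t \<in> {a..b}" "p = f t" using assms by auto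
  then show "0 \<le> d x p" "d x p \<le> d x y" using f(1,3) f(4)[of t] f(4)[of b] by auto
qed

lemma segment_between_point:
  assumes S: "segment_between X d x y S" and "0 \<le> r" "r \<le> d x y"
  obtains p where "p \<in> S" "d x p = r"
proof -
  obtain a b f where f: "a \<le> b" "f ` {a..b} = S" "f b = y"
    "\<And>t. t \<in> {a..b} \<Longrightarrow> d x (f t) = t - a"
    using segment_between_param[OF S] by metis
  have "r \<le> b - a" using f(1,3) f(4)[of b] \<open>r \<le> d x y\<close> by auto
  then have "a + r \<in> {a..b}" using \<open>0 \<le> r\<close> by (auto simp: algebra_simps)
  then show thesis using that[of "f (a + r)"] f(2,4) by auto
qed

lemma segment_between_reverse:
  assumes S: "segment_between X d x y S"
  shows "segment_between X d y x S"
proof -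
  obtain a b f where f: "a \<le> b" "f ` {a..b} = S" "f a = x" "f b = y"
    "\<And>s t. \<lbrakk>s \<in> {a..b}; t \<in> {a..b}\<rbrakk> \<Longrightarrow> d (f s) (f t) = max s t - min s t"
    using segment_between_param[OF S] by metis
  have "(\<lambda>t. f (- t)) ` {- b..- a} = f ` {a..b}"
    by (simp flip: image_image[of f uminus])
  then show ?thesis
    using f segment_between_subset[OF S] unfolding segment_between_def
    by (intro conjI exI[of _ "- b"] exI[of _ "- a"] exI[of _ "\<lambda>t. f (- t)"])
      (auto simp: minus_le_iff le_minus_iff max_def min_def)
qed

lemma segment_between_tail:
  assumes S: "segment_between X d x y S" and "m \<in> S"
  shows "segment_between X d m y {p \<in> S. d x m \<le> d x p}"
proof -
  obtain a b f where f: "a \<le> b" "f ` {a..b} = S" "f a = x" "f b = y"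
    "\<And>s t. \<lbrakk>s \<in> {a..b}; t \<in> {a..b}\<rbrakk> \<Longrightarrow> d (f s) (f t) = max s t - min s t"
    "\<And>t. t \<in> {a..b} \<Longrightarrow> d x (f t) = t - a"
    using segment_between_param[OF S] by blast
  then obtain c where c: "c \<in> {a..b}" "m = f c" using assms by auto
  then have "f ` {c..b} = {p \<in> S. d x m \<le> d x p}"
    using f(6) by (auto simp: f(2)[symmetric])
  then show ?thesis
    using f c segment_between_subset[OF S] unfolding segment_between_def
    by (intro conjI exI[of _ c] exI[of _ b] exI[of _ f]) auto
qed

context
  fixes X :: "'p set" and d :: "'p \<Rightarrow> 'p \<Rightarrow> 'l::linordered_ab_group_add"
  assumes tree: "lambda_tree X d"
begin

lemma
  assumes "x \<in> X" "y \<in> X"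
  shows tree_nonneg: "0 \<le> d x y" and tree_zero_iff: "d x y = 0 \<longleftrightarrow> x = y" and tree_sym: "d x y = d y x"
  using tree assms by (auto simp: lambda_tree_def lambda_metric_def)

lemma segment_between_unique_point:
  assumes S: "segment_between X d x y S" "p \<in> S" "q \<in> S" "d x p = d x q"
  shows "p = q"
  using segment_between_dist[OF S(1-3)] S tree_zero_iff[of p q] segment_between_subset[OF S(1)] by auto

lemma segment_between_dist_end:
  assumes S: "segment_between X d x y S" "p \<in> S"
  shows "d x p + d p y = d x y"
  using segment_between_dist[OF S segment_between_ends(2)[OF S(1)]] segment_between_dist_le[OF S]
  by (simp add: max_def min_def)

text \<open>With \<open>y\<close> and \<open>z\<close> on the same side of \<open>m\<close>, the
  point \<open>p\<close> of \<open>T\<close> as far from \<open>m\<close> as \<open>y\<close> has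
  the same coordinate as \<open>y\<close> in the union. Hence it is \<open>y\<close>, which then
  lies in both segments.\<close>

lemma union_segment_degenerate:
  assumes S: "segment_between X d m y S" and T: "segment_between X d m z T" and "S \<inter> T = {m}"
    and U: "segment_between X d u v (S \<union> T)"
    and le: "d u m \<le> d u y" "d u y \<le> d u z"
  shows "y = m"
proof -
  have UU: "m \<in> S \<union> T" "y \<in> S \<union> T" "z \<in> S \<union> T"
    using segment_between_ends[OF S] segment_between_ends[OF T] by auto
  have my: "d m y = d u y - d u m" and mz: "d m z = d u z - d u m" and yz: "d y z = d u z - d u y"
    using segment_between_dist[OF U UU(1,2)] segment_between_dist[OF U UU(1,3)]
      segment_between_dist[OF U UU(2,3)] le order.trans[OF le] by (auto simp: max_def min_def)
  have "0 \<le> d m y" "d m y \<le> d m z" using le by (auto simp: my mz)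
  then obtain p where p: "p \<in> T" "d m p = d m y" using segment_between_point[OF T] by metis
  then have pU: "p \<in> S \<union> T" by simp
  have "d p z = d u z - d u y"
    using segment_between_dist_end[OF T p(1)] p(2) by (simp add: my mz algebra_simps)
  then have "d u p = d u y"
    using segment_between_dist[OF U UU(1) pU] segment_between_dist[OF U pU UU(3)] p(2) my le
    by (auto simp: max_def min_def algebra_simps split: if_splits)
  then have "p = y" using segment_between_unique_point[OF U pU UU(2)] by simp
  then show ?thesis using p segment_between_ends(2)[OF S] \<open>S \<inter> T = {m}\<close> by auto
qed

text \<open>The tree axiom makes the union a segment, but with unknown ends \<open>u\<close> and
  \<open>v\<close>. Unless \<open>y\<close> or \<open>z\<close> equals \<open>m\<close>, the point
  \<open>m\<close> must separate them in it; reversing the union reduces the case of both lying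
  before \<open>m\<close> to that of both lying after it.\<close>

lemma union_segment_dist:
  assumes S: "segment_between X d m y S" and T: "segment_between X d m z T" and ST: "S \<inter> T = {m}"
  shows "d y z = d m y + d m z"
proof -
  have "is_segment X d (S \<union> T)"
    using tree segment_between_reverse[OF S] T ST unfolding lambda_tree_def by blast
  then obtain u v where U: "segment_between X d u v (S \<union> T)" by (auto simp: is_segment_def)
  have UU: "m \<in> S \<union> T" "y \<in> S \<union> T" "z \<in> S \<union> T"
    using segment_between_ends[OF S] segment_between_ends[OF T] by auto
  have X: "m \<in> X" "y \<in> X" "z \<in> X" using UU segment_between_subset[OF U] by auto
  have TS: "T \<inter> S = {m}" "T \<union> S = S \<union> T" using ST by auto
  have degenerate: "y = m \<or> z = m"
    if U: "segment_between X d u v (S \<union> T)" and "d u m \<le> d u y" "d u m \<le> d u z" for u v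
  proof (cases "d u y \<le> d u z")
    case True
    then show ?thesis using union_segment_degenerate[OF S T ST U] that by simp
  next
    case False
    then show ?thesis using union_segment_degenerate[OF T S TS(1), of u v] that TS by simp
  qed
  have end_dist: "d u p + d v p = d u v" if "p \<in> S \<union> T" for p
  proof -
    have "p \<in> X" "v \<in> X" using that segment_between_subset[OF U] segment_between_ends[OF U] by blast+
    then show ?thesis using segment_between_dist_end[OF U that] tree_sym[of p v] by simp
  qed
  have "d v m \<le> d v p \<longleftrightarrow> d u p \<le> d u m" if "p \<in> S \<union> T" for p
  proof -
    have "d v m = d u v - d u m" "d v p = d u v - d u p"
      using end_dist[OF that] end_dist[OF UU(1)] by (auto simp: algebra_simps)
    then show ?thesis by simp
  qed
  then have "y = m \<or> z = m" if "d u y \<le> d u m" "d u z \<le> d u m"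
    using degenerate[OF segment_between_reverse[OF U]] that UU by blast
  then consider "y = m \<or> z = m" | "d u y \<le> d u m" "d u m \<le> d u z" | "d u z \<le> d u m" "d u m \<le> d u y"
    using degenerate[OF U] by fastforce
  then show ?thesis
  proof cases
    case 1
    then show ?thesis using X tree_zero_iff[of m m] tree_sym[of y m] by auto
  next
    case 2
    then have "d u y \<le> d u z" by simp
    with 2 show ?thesis
      using segment_between_dist[OF U UU(1,2)] segment_between_dist[OF U UU(1,3)]
        segment_between_dist[OF U UU(2,3)] by (auto simp: max_def min_def)
  next
    case 3
    then have "d u z \<le> d u y" by simp
    with 3 show ?thesis
      using segment_between_dist[OF U UU(1,2)] segment_between_dist[OF U UU(1,3)]
        segment_between_dist[OF U UU(2,3)] by (auto simp: max_def min_def)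
  qed
qed

text \<open>The intersection is a segment by the tree axiom, with unknown ends; the end farther from
  \<open>x\<close> is the point where the segments part.\<close>

lemma tree_branch_point:
  assumes S: "segment_between X d x y S" and T: "segment_between X d x z T"
  obtains m where "m \<in> S" "m \<in> T" "d y z = d m y + d m z"
    "\<And>p. \<lbrakk>p \<in> S; p \<in> T\<rbrakk> \<Longrightarrow> d x p \<le> d x m"
    "\<And>p. \<lbrakk>p \<in> S; d x p \<le> d x m\<rbrakk> \<Longrightarrow> p \<in> T"
proof -
  have "is_segment X d (S \<inter> T)" using tree S T unfolding lambda_tree_def by blast
  then obtain u v where W: "segment_between X d u v (S \<inter> T)" by (auto simp: is_segment_def)
  have xW: "x \<in> S \<inter> T" using segment_between_ends(1)[OF S] segment_between_ends(1)[OF T] by simp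
  have WX: "p \<in> X" if "p \<in> S \<inter> T" for p using that segment_between_subset[OF S] by blast
  note ends = segment_between_ends[OF W]
  have "d x p \<le> d u x \<or> d x p \<le> d v x" if p: "p \<in> S \<inter> T" for p
  proof (cases "d u x \<le> d u p")
    case True
    have "d x p = d u p - d u x" using segment_between_dist[OF W xW p] True by simp
    also have "\<dots> \<le> d u v - d u x" using segment_between_dist_le(2)[OF W p] by simp
    also have "\<dots> = d v x"
      using segment_between_dist_end[OF W xW] tree_sym[of x v] WX xW ends by (simp add: algebra_simps)
    finally show ?thesis by simp
  next
    case False
    then have "d x p = d u x - d u p" using segment_between_dist[OF W xW p] by simp
    then show ?thesis using segment_between_dist_le(1)[OF W p] by simp
  qed
  then have near: "d x p \<le> d x u \<or> d x p \<le> d x v" if "p \<in> S \<inter> T" for p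
    using that tree_sym[of u x] tree_sym[of v x] WX xW ends by simp
  have "\<exists>w m. segment_between X d w m (S \<inter> T) \<and> (\<forall>p \<in> S \<inter> T. d x p \<le> d x m)"
  proof (cases "d x u \<le> d x v")
    case True
    then have "\<forall>p \<in> S \<inter> T. d x p \<le> d x v" using near by (metis order_trans)
    then show ?thesis using W by blast
  next
    case False
    then have "\<forall>p \<in> S \<inter> T. d x p \<le> d x u" using near by (metis linear order_trans)
    then show ?thesis using segment_between_reverse[OF W] by blast
  qed
  then obtain w m where W: "segment_between X d w m (S \<inter> T)" and far: "\<And>p. p \<in> S \<inter> T \<Longrightarrow> d x p \<le> d x m"
    by blast
  have m: "m \<in> S \<inter> T" using segment_between_ends[OF W] by simp
  show thesis
  proof
    show "m \<in> S" "m \<in> T" using m by auto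
    show "d x p \<le> d x m" if "p \<in> S" "p \<in> T" for p using far that by blast
    show "p \<in> T" if p: "p \<in> S" "d x p \<le> d x m" for p
    proof -
      have W': "segment_between X d m w (S \<inter> T)" using segment_between_reverse[OF W] .
      have mx: "d m x = d x m" using tree_sym m xW segment_between_subset[OF S] by blast
      \<comment> \<open>The intersection contains a point at the same distance from \<open>x\<close>
        as \<open>p\<close>; as both lie on \<open>S\<close>, it is \<open>p\<close>.\<close>
      have "0 \<le> d m x - d x p" using p mx by simp
      moreover have "d m x - d x p \<le> d m w"
        using segment_between_dist_le[OF S p(1)] segment_between_dist_le(2)[OF W' xW]
        by (meson diff_left_mono diff_zero order_trans diff_le_eq le_add_same_cancel1)
      ultimately obtain p' where p': "p' \<in> S \<inter> T" "d m p' = d m x - d x p"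
        using segment_between_point[OF W'] by metis
      have "d x p' = d x p"
        using segment_between_dist[OF W' xW p'(1)] p' segment_between_dist_le(1)[OF S p(1)]
        by (auto simp: max_def min_def)
      then have "p' = p" using segment_between_unique_point[OF S] p' p by blast
      then show ?thesis using p' by simp
    qed
    \<comment> \<open>Beyond \<open>m\<close> the two segments share nothing, so their tails fit
      together at \<open>m\<close>.\<close>
    have "{p \<in> S. d x m \<le> d x p} \<inter> {p \<in> T. d x m \<le> d x p} = {m}"
      using far m segment_between_unique_point[OF S] by (auto intro: order.antisym)
    then show "d y z = d m y + d m z"
      using union_segment_dist segment_between_tail[OF S, of m] segment_between_tail[OF T, of m] m by blast
  qed
qed

text \<open>The branch point of the segments from \<open>x\<close> to \<open>y\<close> and
  \<open>z\<close> is a median. The four-point inequality is an ultrametric inequality for the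
  distances from \<open>t\<close> to the branch points of the segments to \<open>x\<close>,
  \<open>y\<close> and \<open>z\<close>.\<close>

lemma tree_metric_lambda_tree: "tree_metric X d"
proof
  show "X \<noteq> {}" using tree by (simp add: lambda_tree_def)
  have seg: "\<exists>S. segment_between X d x y S" if "x \<in> X" "y \<in> X" for x y
    using tree that by (simp add: lambda_tree_def)
  fix x y assume xy: "x \<in> X" "y \<in> X"
  then show "0 \<le> d x y" "d x y = 0 \<longleftrightarrow> x = y" "d x y = d y x"
    using tree_nonneg tree_zero_iff tree_sym by blast+
  fix z assume z: "z \<in> X"
  obtain S T where S: "segment_between X d x y S" and T: "segment_between X d x z T"
    using seg xy z by blast
  obtain m where m: "m \<in> S" "m \<in> T" "d y z = d m y + d m z"
    using tree_branch_point[OF S T] by metis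
  have "m \<in> X" using m segment_between_subset[OF S] by blast
  then show "\<exists>m\<in>X. d x m + d m y = d x y \<and> d y m + d m z = d y z \<and> d x m + d m z = d x z"
    using m segment_between_dist_end[OF S] segment_between_dist_end[OF T] tree_sym[of y m] xy by (intro bexI[of _ m]) auto
next
  have seg: "\<exists>S. segment_between X d x y S" if "x \<in> X" "y \<in> X" for x y
    using tree that by (simp add: lambda_tree_def)
  fix x y z t assume xyzt: "x \<in> X" "y \<in> X" "z \<in> X" "t \<in> X"
  obtain A where A: "segment_between X d t x A" using seg[OF xyzt(4,1)] by blast
  obtain B where B: "segment_between X d t y B" using seg[OF xyzt(4,2)] by blast
  obtain C where C: "segment_between X d t z C" using seg[OF xyzt(4,3)] by blast
  obtain p where p: "p \<in> B" "p \<in> A" "d y x = d p y + d p x" 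
      "\<And>q. \<lbrakk>q \<in> B; d t q \<le> d t p\<rbrakk> \<Longrightarrow> q \<in> A"
    using tree_branch_point[OF B A] by metis
  obtain q where q: "q \<in> B" "q \<in> C" "d y z = d q y + d q z"
      "\<And>p. \<lbrakk>p \<in> B; d t p \<le> d t q\<rbrakk> \<Longrightarrow> p \<in> C"
    using tree_branch_point[OF B C] by metis
  obtain r where r: "r \<in> A" "r \<in> C" "d x z = d r x + d r z"
      "\<And>p. \<lbrakk>p \<in> A; p \<in> C\<rbrakk> \<Longrightarrow> d t p \<le> d t r"
    using tree_branch_point[OF A C] by metis
  have yx: "d x y = (d t y - d t p) + (d t x - d t p)"
    using p segment_between_dist_end[OF A, of p] segment_between_dist_end[OF B, of p] tree_sym[of x y] xyzt
    by (metis add_diff_cancel_left')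
  have yz: "d y z = (d t y - d t q) + (d t z - d t q)"
    using q segment_between_dist_end[OF C, of q] segment_between_dist_end[OF B, of q]
    by (metis add_diff_cancel_left')
  have xz: "d x z = (d t x - d t r) + (d t z - d t r)"
    using r segment_between_dist_end[OF A, of r] segment_between_dist_end[OF C, of r]
    by (metis add_diff_cancel_left')
  have sym: "d y t = d t y" "d z t = d t z" "d x t = d t x" using tree_sym xyzt by blast+
  show "d x z + d y t \<le> max (d x y + d z t) (d y z + d x t)"
  proof (cases "d t p \<le> d t q")
    case True
    \<comment> \<open>On \<open>B\<close>, the point \<open>p\<close> comes no later than
      \<open>q\<close>, so it also lies on \<open>C\<close>. Being common to \<open>A\<close> and
      \<open>C\<close>, it is no farther from \<open>t\<close> than \<open>r\<close>.\<close>
    then have "d t p \<le> d t r" using p q(4) r(4) by blast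
    then have "d t p + d t p \<le> d t r + d t r" by (intro add_mono)
    then have "d x z + d y t \<le> d x y + d z t" by (simp add: xz yx sym algebra_simps)
    then show ?thesis by (simp add: le_max_iff_disj)
  next
    case False
    then have "d t q \<le> d t r" using q p(4)[of q] r(4) by auto
    then have "d t q + d t q \<le> d t r + d t r" by (intro add_mono)
    then have "d x z + d y t \<le> d y z + d x t" by (simp add: xz yz sym algebra_simps)
    then show ?thesis by (simp add: le_max_iff_disj)
  qed
qed

end

lemma csa_group_free_tree_action:
  fixes G (structure)
  assumes G: "group G" and tree: "lambda_tree X d" and act: "acts_freely_on_tree G X d \<phi>"
  shows "csa_group G"
proof -
  interpret group G by fact
  interpret tree_metric X d using tree by (rule tree_metric_lambda_tree)
  have act: "group_action G X \<phi>" and isom: "\<forall>g\<in>carrier G. \<forall>x\<in>X. \<forall>y\<in>X. d (\<phi> g x) (\<phi> g y) = d x y"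
    and no_inversion: "without_inversions G X \<phi>"
    and free: "\<forall>g\<in>carrier G. g \<noteq> \<one> \<longrightarrow> (\<forall>x\<in>X. \<phi> g x \<noteq> x)"
    using act by (auto simp: acts_freely_on_tree_def isometric_action_def)
  interpret free_tree_action G X d \<phi>
  proof
    show "\<phi> g p \<in> X" if "g \<in> carrier G" "p \<in> X" for g p
      using group_action.element_image[OF act that] by simp
    show "\<phi> (g \<otimes> h) p = \<phi> g (\<phi> h p)" if "g \<in> carrier G" "h \<in> carrier G" "p \<in> X" for g h p
      using group_action.composition_rule[OF act] that by simp
    show "\<phi> \<one> p = p" if "p \<in> X" for p
      using group_action.id_eq_one[OF act] that by (metis restrict_apply')
    show "d (\<phi> g p) (\<phi> g q) = d p q" if "g \<in> carrier G" "p \<in> X" "q \<in> X" for g p q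
      using isom that by simp
    show "\<phi> g (\<phi> g p) \<noteq> p" if "g \<in> carrier G" "g \<noteq> \<one>" "p \<in> X" for g p
      using no_inversion free that unfolding without_inversions_def by blast
  qed
  show ?thesis by (rule csa_group)
qed

section \<open>Free groups\<close>

lemma (in group) word_value_closed:
  "w \<in> words (carrier G) \<Longrightarrow> word_value G w \<in> carrier G"
  by (induction w) (auto simp: words_def word_value_def letter_value_def)

lemma (in group) word_value_append:
  assumes "u \<in> words (carrier G)" "v \<in> words (carrier G)"
  shows "word_value G (u @ v) = word_value G u \<otimes> word_value G v"
  using assms
proof (induction u)
  case Nil
  then show ?case using word_value_closed[of v] by (simp add: word_value_def)
next
  case (Cons l u)
  then have "l \<in> carrier G \<times> UNIV" "u \<in> words (carrier G)" by (auto simp: words_def)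
  then have "letter_value G l \<in> carrier G" by (auto simp: letter_value_def)
  then show ?case
    using Cons word_value_closed[of u] word_value_closed[of v] \<open>u \<in> _\<close>
    by (simp add: word_value_def m_assoc)
qed

definition inverse_word :: "('a \<times> bool) list \<Rightarrow> ('a \<times> bool) list" where
  "inverse_word w = rev (map (\<lambda>(x, s). (x, \<not> s)) w)"

lemma length_inverse_word [simp]: "length (inverse_word w) = length w"
  by (simp add: inverse_word_def)

lemma inverse_word_words: "w \<in> words X \<Longrightarrow> inverse_word w \<in> words X"
  by (auto simp: inverse_word_def words_def)

lemma words_mono: "X \<subseteq> Y \<Longrightarrow> words X \<subseteq> words Y"
  unfolding words_def by (rule lists_mono) auto

lemma words_append [simp]: "u @ v \<in> words X \<longleftrightarrow> u \<in> words X \<and> v \<in> words X"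
  by (auto simp: words_def)

lemma (in group) word_value_inverse_word:
  assumes "w \<in> words (carrier G)"
  shows "word_value G (inverse_word w) = inv (word_value G w)"
  using assms
proof (induction w)
  case Nil
  then show ?case by (simp add: inverse_word_def word_value_def)
next
  case (Cons l w)
  obtain x s where l: "l = (x, s)" by fastforce
  have x: "x \<in> carrier G" and w: "w \<in> words (carrier G)" using Cons.prems by (auto simp: words_def l)
  have "[(x, \<not> s)] \<in> words (carrier G)" using x by (simp add: words_def)
  then have "word_value G (inverse_word (l # w)) = inv (word_value G w) \<otimes> word_value G [(x, \<not> s)]"
    using word_value_append[OF inverse_word_words[OF w], of "[(x, \<not> s)]"] Cons.IH[OF w]
    by (simp add: inverse_word_def l)
  then show ?case
    using x word_value_closed[OF w] by (simp add: word_value_def letter_value_def l inv_mult_group)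
qed

lemma longest_common_prefix_split:
  obtains u' v' where "u = longest_common_prefix u v @ u'" "v = longest_common_prefix u v @ v'"
    "u' = [] \<or> v' = [] \<or> hd u' \<noteq> hd v'"
proof (induction u v arbitrary: thesis rule: longest_common_prefix.induct)
  case (1 x xs y ys)
  show ?case
  proof (cases "x = y")
    case True
    then show ?thesis using 1(1)[OF True] 1(2) by auto
  next
    case False
    then show ?thesis using 1(2)[of "x # xs" "y # ys"] by simp
  qed
qed auto

lemma longest_common_prefix_commute: "longest_common_prefix u v = longest_common_prefix v u"
  by (induction u v rule: longest_common_prefix.induct) auto

lemma longest_common_prefix_append [simp]: "longest_common_prefix p (p @ u) = p"
  by (induction p) auto

text \<open>Both prefixes on the left are prefixes of \<open>v\<close>, so one extends the other and
  the shorter one is a prefix of all three words.\<close>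

lemma longest_common_prefix_ultrametric:
  "min (length (longest_common_prefix u v)) (length (longest_common_prefix v w))
    \<le> length (longest_common_prefix u w)"
proof -
  let ?p = "longest_common_prefix u v" and ?q = "longest_common_prefix v w"
  have uv: "prefix ?p u" "prefix ?p v" and vw: "prefix ?q v" "prefix ?q w"
    by (simp_all add: longest_common_prefix_prefix1 longest_common_prefix_prefix2)
  then have "prefix ?p ?q \<or> prefix ?q ?p" using prefix_same_cases by blast
  then have "prefix ?p (longest_common_prefix u w) \<or> prefix ?q (longest_common_prefix u w)"
    using uv vw longest_common_prefix_max_prefix prefix_order.trans by metis
  then show ?thesis using prefix_length_le by fastforce
qed

lemma reduced_word_append:
  "reduced_word (u @ v) \<longleftrightarrow> reduced_word u \<and> reduced_word v
    \<and> (u = [] \<or> v = [] \<or> fst (last u) \<noteq> fst (hd v) \<or> snd (last u) = snd (hd v))"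
  by (auto simp: reduced_word_def successively_append_iff split: prod.splits)

lemma reduced_word_inverse_word: "reduced_word w \<Longrightarrow> reduced_word (inverse_word w)"
  unfolding reduced_word_def inverse_word_def successively_rev successively_map
  by (erule successively_mono) auto

lemma reduced_word_inverse_word_append:
  assumes "reduced_word u" "reduced_word v" "u = [] \<or> v = [] \<or> hd u \<noteq> hd v"
  shows "reduced_word (inverse_word u @ v)"
proof -
  have "last (inverse_word u) = (fst (hd u), \<not> snd (hd u))" if "u \<noteq> []"
    using that by (cases u) (auto simp: inverse_word_def case_prod_beta)
  moreover have "inverse_word u = [] \<longleftrightarrow> u = []" by (simp add: inverse_word_def)
  ultimately show ?thesis
    using assms reduced_word_inverse_word[OF assms(1)] by (auto simp: reduced_word_append prod_eq_iff)
qed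

text \<open>In odd length the middle letter would be its own inverse, in even length the two middle
  letters would cancel. Hence a free group has no involutions.\<close>

lemma inverse_word_fixed:
  assumes "reduced_word w" "inverse_word w = w"
  shows "w = []"
proof (rule ccontr)
  assume "w \<noteq> []"
  define n where "n = length w"
  have flip: "w ! i = (fst (w ! (n - 1 - i)), \<not> snd (w ! (n - 1 - i)))" if "i < n" for i
  proof -
    have "w ! i = inverse_word w ! i" using assms by simp
    then show ?thesis
      using that by (simp add: inverse_word_def rev_nth n_def case_prod_beta)
  qed
  have "n > 0" using \<open>w \<noteq> []\<close> by (simp add: n_def)
  show False
  proof (cases "even n")
    case False
    then have "n - 1 - n div 2 = n div 2" "n div 2 < n" using \<open>n > 0\<close> by (auto elim!: oddE)
    then show False using flip[of "n div 2"] by (metis snd_conv)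
  next
    case True
    define i where "i = n div 2 - 1"
    have i: "n - 1 - i = Suc i" "Suc i < n" using True \<open>n > 0\<close> by (auto simp: i_def elim!: evenE)
    have "fst (w ! i) = fst (w ! Suc i) \<longrightarrow> snd (w ! i) = snd (w ! Suc i)"
      using assms(1) i(2) by (auto simp: reduced_word_def successively_conv_nth n_def case_prod_beta)
    then show False using flip[of i] i by (metis Suc_lessD fst_conv snd_conv)
  qed
qed

section \<open>The tree metric of a free group\<close>

locale free_group_basis = group F for F :: "('a, 'm) monoid_scheme" (structure) +
  fixes X assumes basis: "free_basis F X"
begin

definition normal_form :: "'a \<Rightarrow> ('a \<times> bool) list" where
  "normal_form = the_inv_into {w \<in> words X. reduced_word w} (word_value F)"

lemma words_closed: "w \<in> words X \<Longrightarrow> w \<in> words (carrier F)"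
  using basis words_mono[of X "carrier F"] by (auto simp: free_basis_def)

lemma
  assumes "g \<in> carrier F"
  shows normal_form_words: "normal_form g \<in> words X"
    and reduced_normal_form: "reduced_word (normal_form g)"
    and word_value_normal_form: "word_value F (normal_form g) = g"
proof -
  have inj: "inj_on (word_value F) {w \<in> words X. reduced_word w}"
    and g: "g \<in> word_value F ` {w \<in> words X. reduced_word w}"
    using basis assms by (auto simp: free_basis_def bij_betw_def)
  show "normal_form g \<in> words X" "reduced_word (normal_form g)" "word_value F (normal_form g) = g"
    using the_inv_into_into[OF inj g subset_refl] f_the_inv_into_f[OF inj g] by (auto simp: normal_form_def)
qed

lemma normal_form_word_value:
  assumes "w \<in> words X" "reduced_word w"
  shows "normal_form (word_value F w) = w"
  using basis assms the_inv_into_f_f[of "word_value F" "{w \<in> words X. reduced_word w}" w]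
  by (auto simp: free_basis_def bij_betw_def normal_form_def)

text \<open>Integer values, since the distances of a \<open>tree_metric\<close> lie in an ordered
  group.\<close>

definition free_dist :: "'a \<Rightarrow> 'a \<Rightarrow> int" where
  "free_dist g h = int (length (normal_form (inv g \<otimes> h)))"

definition common_prefix :: "'a \<Rightarrow> 'a \<Rightarrow> ('a \<times> bool) list" where
  "common_prefix g h = longest_common_prefix (normal_form g) (normal_form h)"

text \<open>After the common prefix the remainders \<open>u\<close> and \<open>v\<close> start with
  different letters, so nothing cancels in \<open>inverse_word u @ v\<close>. The Gromov product at
  \<one> is thus the length of the common prefix.\<close>

lemma free_dist_normal_form:
  assumes "g \<in> carrier F" "h \<in> carrier F"
  shows "free_dist g h = int (length (normal_form g)) + int (length (normal_form h))
    - 2 * int (length (common_prefix g h))"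
proof -
  define p where "p = common_prefix g h"
  obtain u v where uv: "normal_form g = p @ u" "normal_form h = p @ v" "u = [] \<or> v = [] \<or> hd u \<noteq> hd v"
    unfolding p_def common_prefix_def by (rule longest_common_prefix_split)
  have W: "p \<in> words X" "u \<in> words X" "v \<in> words X"
    using normal_form_words[OF assms(1)] normal_form_words[OF assms(2)] by (auto simp: uv)
  note WF = W[THEN words_closed]
  note V = WF[THEN word_value_closed]
  have "reduced_word u" "reduced_word v"
    using reduced_normal_form[OF assms(1)] reduced_normal_form[OF assms(2)] by (auto simp: uv reduced_word_append)
  then have red: "reduced_word (inverse_word u @ v)" using uv(3) by (rule reduced_word_inverse_word_append)
  have gh: "g = word_value F p \<otimes> word_value F u" "h = word_value F p \<otimes> word_value F v"
    using word_value_normal_form[OF assms(1)] word_value_normal_form[OF assms(2)] WF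
    by (simp_all add: uv word_value_append)
  have "inv g \<otimes> h = inv (word_value F u) \<otimes> ((inv (word_value F p) \<otimes> word_value F p) \<otimes> word_value F v)"
    using V by (simp only: gh inv_mult_group m_assoc m_closed inv_closed)
  also have "\<dots> = word_value F (inverse_word u @ v)"
    using V WF by (simp add: word_value_append inverse_word_words word_value_inverse_word)
  finally have "normal_form (inv g \<otimes> h) = inverse_word u @ v"
    using normal_form_word_value[OF _ red] W by (simp add: inverse_word_words)
  then show ?thesis by (simp add: free_dist_def uv flip: p_def)
qed

lemma free_dist_translate:
  assumes "k \<in> carrier F" "g \<in> carrier F" "h \<in> carrier F"
  shows "free_dist (k \<otimes> g) (k \<otimes> h) = free_dist g h"
proof -
  have "inv (k \<otimes> g) \<otimes> (k \<otimes> h) = inv g \<otimes> ((inv k \<otimes> k) \<otimes> h)"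
    using assms by (simp only: inv_mult_group m_assoc m_closed inv_closed)
  then show ?thesis using assms by (simp add: free_dist_def)
qed

sublocale tree_metric "carrier F" free_dist
proof
  show "carrier F \<noteq> {}" by auto
  fix x y assume xy: "x \<in> carrier F" "y \<in> carrier F"
  show "0 \<le> free_dist x y" by (simp add: free_dist_def)
  show "free_dist x y = 0 \<longleftrightarrow> x = y"
  proof
    assume "free_dist x y = 0"
    then have "inv x \<otimes> y = \<one>"
      using word_value_normal_form[of "inv x \<otimes> y"] xy by (simp add: free_dist_def word_value_def)
    then show "x = y" using xy by (metis inv_equality inv_inv inv_closed)
  next
    assume "x = y"
    moreover have "normal_form \<one> = []"
      using normal_form_word_value[of "[]"] by (simp add: words_def word_value_def reduced_word_def)
    ultimately show "free_dist x y = 0" using xy by (simp add: free_dist_def)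
  qed
  show "free_dist x y = free_dist y x"
    using xy longest_common_prefix_commute[of "normal_form x"] by (simp add: free_dist_normal_form common_prefix_def)
  fix z assume z: "z \<in> carrier F"
  show "\<exists>m\<in>carrier F. free_dist x m + free_dist m y = free_dist x y \<and>
    free_dist y m + free_dist m z = free_dist y z \<and> free_dist x m + free_dist m z = free_dist x z"
  proof -
    \<comment> \<open>With \<open>x\<close> translated to \<one>, the median is the element spelled
      by the common prefix of the other two normal forms.\<close>
    define b c where "b = inv x \<otimes> y" and "c = inv x \<otimes> z"
    have bc: "b \<in> carrier F" "c \<in> carrier F" "y = x \<otimes> b" "z = x \<otimes> c"
      using xy z by (auto simp: b_def c_def simp flip: m_assoc)
    define p where "p = common_prefix b c"
    obtain u v where uv: "normal_form b = p @ u" "normal_form c = p @ v"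
      unfolding p_def common_prefix_def by (rule longest_common_prefix_split)
    have p: "p \<in> words X" "reduced_word p"
      using normal_form_words[OF bc(1)] reduced_normal_form[OF bc(1)] by (auto simp: uv reduced_word_append)
    define m where "m = word_value F p"
    have m: "m \<in> carrier F" "normal_form m = p"
      using p word_value_closed words_closed normal_form_word_value by (auto simp: m_def)
    have one: "free_dist \<one> g = int (length (normal_form g))" if "g \<in> carrier F" for g
      using that by (simp add: free_dist_def)
    have x1: "free_dist x (x \<otimes> g) = int (length (normal_form g))" if "g \<in> carrier F" for g
      using free_dist_translate[of x \<one> g] xy that one by simp
    have bm: "free_dist b m = int (length u)" "free_dist m b = int (length u)" "free_dist m c = int (length v)"
      using bc m longest_common_prefix_commute[of "p @ u" p]
      by (simp_all add: free_dist_normal_form common_prefix_def uv)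
    have "free_dist b c = int (length u) + int (length v)"
      using bc by (simp add: free_dist_normal_form uv flip: p_def)
    then show ?thesis
      using xy bc m bm x1 uv by (intro bexI[of _ "x \<otimes> m"]) (simp_all add: free_dist_translate)
  qed
  fix t assume t: "t \<in> carrier F"
  show "free_dist x z + free_dist y t \<le> max (free_dist x y + free_dist z t) (free_dist y z + free_dist x t)"
  proof -
    \<comment> \<open>With \<open>t\<close> translated to \<one>, the claim becomes the ultrametric
      inequality for common prefixes.\<close>
    define a b c where "a = inv t \<otimes> x" and "b = inv t \<otimes> y" and "c = inv t \<otimes> z"
    have abc: "a \<in> carrier F" "b \<in> carrier F" "c \<in> carrier F" "x = t \<otimes> a" "y = t \<otimes> b" "z = t \<otimes> c"
      using t xy z by (auto simp: a_def b_def c_def simp flip: m_assoc)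
    have "normal_form \<one> = []"
      using normal_form_word_value[of "[]"] by (simp add: words_def word_value_def reduced_word_def)
    then have "free_dist (t \<otimes> g) t = int (length (normal_form g))" if "g \<in> carrier F" for g
      using free_dist_translate[of t g \<one>] t that
      by (simp add: free_dist_normal_form common_prefix_def longest_common_prefix_commute[of _ "[]"])
    then have "free_dist x t = int (length (normal_form a))" "free_dist y t = int (length (normal_form b))"
      "free_dist z t = int (length (normal_form c))"
      using abc by auto
    moreover have "min (length (common_prefix a b)) (length (common_prefix b c)) \<le> length (common_prefix a c)"
      unfolding common_prefix_def by (rule longest_common_prefix_ultrametric)
    moreover have "free_dist x z = int (length (normal_form a)) + int (length (normal_form c))
          - 2 * int (length (common_prefix a c))"
        "free_dist x y = int (length (normal_form a)) + int (length (normal_form b))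
          - 2 * int (length (common_prefix a b))"
        "free_dist y z = int (length (normal_form b)) + int (length (normal_form c))
          - 2 * int (length (common_prefix b c))"
      using free_dist_normal_form[OF abc(1,3)] free_dist_normal_form[OF abc(1,2)]
        free_dist_normal_form[OF abc(2,3)] t abc by (simp_all add: free_dist_translate)
    ultimately show ?thesis by linarith
  qed
qed

sublocale free_tree_action F "carrier F" free_dist "(\<otimes>)"
proof
  fix g p assume g: "g \<in> carrier F" "g \<noteq> \<one>" and p: "p \<in> carrier F"
  show "g \<otimes> (g \<otimes> p) \<noteq> p"
  proof
    assume "g \<otimes> (g \<otimes> p) = p"
    then have "(g \<otimes> g) \<otimes> p = p" using g p by (simp add: m_assoc)
    then have "g \<otimes> g = \<one>" using g p by simp
    \<comment> \<open>The normal form of an involution would be its own inverse word.\<close>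
    then have "inv g = g" using g inv_equality by blast
    then have "word_value F (inverse_word (normal_form g)) = g"
      using g word_value_inverse_word[of "normal_form g"] normal_form_words words_closed
      by (simp add: word_value_normal_form)
    then have "inverse_word (normal_form g) = normal_form g"
      using normal_form_word_value[of "inverse_word (normal_form g)"] g
      by (simp add: inverse_word_words normal_form_words reduced_normal_form reduced_word_inverse_word)
    then have "normal_form g = []" using inverse_word_fixed reduced_normal_form g by blast
    then show False using word_value_normal_form[OF g(1)] g(2) by (simp add: word_value_def)
  qed
qed (auto simp: m_assoc free_dist_translate)

end

section \<open>The CSA criterion as two universal sentences\<close>

definition commute_formula :: "group_term \<Rightarrow> group_term \<Rightarrow> group_formula" where
  "commute_formula t u = Eq (Mult t u) (Mult u t)"

text \<open>Implication is not primitive: premises and negated conclusion are joined by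
  \<open>Conj\<close> and negated. The variables 0, 1, 2 are the \<open>x\<close>, \<open>y\<close>,
  \<open>z\<close> of the criterion.\<close>

definition centralizer_sentence :: group_formula where
  "centralizer_sentence = foldr Forall [0, 1, 2]
     (Neg (Conj (Conj (Neg (Eq (Var 0) One)) (commute_formula (Var 0) (Var 1)))
       (Conj (commute_formula (Var 0) (Var 2)) (Neg (commute_formula (Var 1) (Var 2))))))"

definition conjugate_sentence :: group_formula where
  "conjugate_sentence = foldr Forall [0, 1]
     (Neg (Conj (Conj (Neg (Eq (Var 0) One))
         (commute_formula (Var 0) (Mult (Mult (Var 1) (Var 0)) (Inv (Var 1)))))
       (Neg (commute_formula (Var 0) (Var 1)))))"

lemma (in group) centralizer_sentence_iff:
  "centralizer_sentence \<in> universal_theory G \<longleftrightarrow>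
     (\<forall>x\<in>carrier G. \<forall>y\<in>carrier G. \<forall>z\<in>carrier G.
        x \<noteq> \<one> \<and> x \<otimes> y = y \<otimes> x \<and> x \<otimes> z = z \<otimes> x \<longrightarrow> y \<otimes> z = z \<otimes> y)"
proof -
  have "\<exists>ns q. quantifier_free q \<and> centralizer_sentence = foldr Forall ns q"
    unfolding centralizer_sentence_def
    by (rule exI, rule exI, rule conjI[rotated], rule refl) (simp add: commute_formula_def)
  moreover have "free_vars centralizer_sentence = {}"
    by (auto simp: centralizer_sentence_def commute_formula_def)
  ultimately have "universal_sentence centralizer_sentence"
    by (simp add: universal_sentence_def)
  \<comment> \<open>The theory quantifies over valuations, so one must exist before a property can
    be read off; the quantifiers then overwrite every variable that occurs.\<close>
  moreover have "\<exists>v :: nat \<Rightarrow> 'a. range v \<subseteq> carrier G" by (intro exI[of _ "\<lambda>_. \<one>"]) auto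
  ultimately show ?thesis
    by (auto simp: universal_theory_def centralizer_sentence_def commute_formula_def)
qed

lemma (in group) conjugate_sentence_iff:
  "conjugate_sentence \<in> universal_theory G \<longleftrightarrow>
     (\<forall>x\<in>carrier G. \<forall>y\<in>carrier G.
        x \<noteq> \<one> \<and> x \<otimes> (y \<otimes> x \<otimes> inv y) = (y \<otimes> x \<otimes> inv y) \<otimes> x \<longrightarrow> x \<otimes> y = y \<otimes> x)"
proof -
  have "\<exists>ns q. quantifier_free q \<and> conjugate_sentence = foldr Forall ns q"
    unfolding conjugate_sentence_def
    by (rule exI, rule exI, rule conjI[rotated], rule refl) (simp add: commute_formula_def)
  moreover have "free_vars conjugate_sentence = {}"
    by (auto simp: conjugate_sentence_def commute_formula_def)
  ultimately have "universal_sentence conjugate_sentence"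
    by (simp add: universal_sentence_def)
  moreover have "\<exists>v :: nat \<Rightarrow> 'a. range v \<subseteq> carrier G" by (intro exI[of _ "\<lambda>_. \<one>"]) auto
  ultimately show ?thesis
    by (auto simp: universal_theory_def conjugate_sentence_def commute_formula_def)
qed

lemma csa_group_universally_free:
  fixes G (structure)
  assumes "universally_free TYPE('f) G"
  shows "csa_group G"
proof -
  obtain F :: "'f monoid" and X where "group F" and X: "free_basis F X"
    and eq: "universal_theory G = universal_theory F" and "group G"
    using assms by (auto simp: universally_free_def free_group_def)
  interpret F: group F by fact
  interpret F: free_group_basis F X by unfold_locales fact
  interpret group G by fact
  have "centralizer_sentence \<in> universal_theory G"
    unfolding eq F.centralizer_sentence_iff by (intro ballI impI, elim conjE) (rule F.centralizer_commute)
  then have centralizer: "\<forall>x\<in>carrier G. \<forall>y\<in>carrier G. \<forall>z\<in>carrier G.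
      x \<noteq> \<one> \<and> x \<otimes> y = y \<otimes> x \<and> x \<otimes> z = z \<otimes> x \<longrightarrow> y \<otimes> z = z \<otimes> y"
    unfolding centralizer_sentence_iff .
  have "conjugate_sentence \<in> universal_theory G"
    unfolding eq F.conjugate_sentence_iff by (intro ballI impI, elim conjE) (rule F.conjugate_commute)
  then have conjugate: "\<forall>x\<in>carrier G. \<forall>y\<in>carrier G.
      x \<noteq> \<one> \<and> x \<otimes> (y \<otimes> x \<otimes> inv y) = (y \<otimes> x \<otimes> inv y) \<otimes> x \<longrightarrow> x \<otimes> y = y \<otimes> x"
    unfolding conjugate_sentence_iff .
  show ?thesis
  proof (rule csa_groupI[OF is_group])
    show "y \<otimes> z = z \<otimes> y" if "x \<in> carrier G" "y \<in> carrier G" "z \<in> carrier G" "x \<noteq> \<one>"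
      "x \<otimes> y = y \<otimes> x" "x \<otimes> z = z \<otimes> x" for x y z
      using centralizer that by blast
    show "x \<otimes> y = y \<otimes> x" if "x \<in> carrier G" "y \<in> carrier G" "x \<noteq> \<one>"
      "x \<otimes> (y \<otimes> x \<otimes> inv y) = (y \<otimes> x \<otimes> inv y) \<otimes> x" for x y
      using conjugate that by blast
  qed
qed

section \<open>Torsion-free hyperbolic groups\<close>

context group
begin

context
  fixes X assumes X: "X \<subseteq> carrier G" "generate G X = carrier G"
begin

lemma word_exists:
  assumes "g \<in> carrier G"
  shows "\<exists>w \<in> words X. word_value G w = g"
proof -
  have "g \<in> generate G X" using assms X by simp
  then show ?thesis
  proof induction
    case one
    show ?case by (rule bexI[of _ "[]"]) (auto simp: words_def word_value_def)
  next
    case (incl h)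
    then show ?case using X by (intro bexI[of _ "[(h, True)]"]) (auto simp: words_def word_value_def letter_value_def)
  next
    case (inv h)
    then show ?case using X by (intro bexI[of _ "[(h, False)]"]) (auto simp: words_def word_value_def letter_value_def)
  next
    case (eng h1 h2)
    then show ?case using word_value_append words_mono[OF X(1)] by (metis subsetD words_append)
  qed
qed

lemma word_length_le:
  assumes "w \<in> words X"
  shows "word_length G X (word_value G w) \<le> length w"
  unfolding word_length_def by (rule Least_le) (use assms in auto)

lemma word_length_word:
  assumes "g \<in> carrier G"
  obtains w where "w \<in> words X" "word_value G w = g" "length w = word_length G X g"
proof -
  have "\<exists>n. \<exists>w \<in> words X. length w = n \<and> word_value G w = g" using word_exists[OF assms] by blast
  from LeastI_ex[OF this] show thesis using that by (auto simp: word_length_def)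
qed

lemma word_length_one: "word_length G X \<one> = 0"
  using word_length_le[of "[]"] by (simp add: words_def word_value_def)

lemma word_length_mult:
  assumes "g \<in> carrier G" "h \<in> carrier G"
  shows "word_length G X (g \<otimes> h) \<le> word_length G X g + word_length G X h"
proof -
  obtain u where u: "u \<in> words X" "word_value G u = g" "length u = word_length G X g"
    using word_length_word assms by metis
  obtain v where v: "v \<in> words X" "word_value G v = h" "length v = word_length G X h"
    using word_length_word assms by metis
  have "word_value G (u @ v) = g \<otimes> h"
    using u v word_value_append words_mono[OF X(1)] by blast
  then show ?thesis
    using word_length_le[of "u @ v"] u v by simp
qed

lemma word_length_inv:
  assumes "g \<in> carrier G"
  shows "word_length G X (inv g) = word_length G X g"
proof -
  have "word_length G X (inv g) \<le> word_length G X g" if "g \<in> carrier G" for g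
    using word_length_word[OF that] word_length_le inverse_word_words word_value_inverse_word words_mono[OF X(1)]
    by (metis length_inverse_word subsetD)
  from this[of g] this[of "inv g"] show ?thesis using assms by simp
qed

text \<open>Cutting a shortest word after \<open>n\<close> letters yields a point on a geodesic from
  \<one> to \<open>g\<close>; later it provides midpoints.\<close>

lemma word_length_split:
  assumes "g \<in> carrier G" "n \<le> word_length G X g"
  obtains c where "c \<in> carrier G" "word_length G X c \<le> n" "word_length G X (inv c \<otimes> g) \<le> word_length G X g - n"
proof -
  obtain w where w: "w \<in> words X" "word_value G w = g" "length w = word_length G X g"
    using word_length_word assms by metis
  define u v where "u = take n w" and "v = drop n w"
  have uv: "u \<in> words X" "v \<in> words X" and "w = u @ v"
    using w words_append[of u v X] by (auto simp: u_def v_def)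
  then have G: "u \<in> words (carrier G)" "v \<in> words (carrier G)" using words_mono[OF X(1)] by auto
  show thesis
  proof
    show "word_value G u \<in> carrier G" using G word_value_closed by blast
    show "word_length G X (word_value G u) \<le> n"
      using word_length_le[OF uv(1)] by (simp add: u_def)
    have "inv (word_value G u) \<otimes> g = word_value G v"
      using w \<open>w = u @ v\<close> word_value_append[OF G] G[THEN word_value_closed] assms
      by (metis inv_solve_left)
    then show "word_length G X (inv (word_value G u) \<otimes> g) \<le> word_length G X g - n"
      using word_length_le[OF uv(2)] w by (simp add: v_def)
  qed
qed

lemma finite_word_length_ball:
  assumes "finite X"
  shows "finite {g \<in> carrier G. word_length G X g \<le> n}"
proof (rule finite_subset)
  show "{g \<in> carrier G. word_length G X g \<le> n} \<subseteq> word_value G ` {w. set w \<subseteq> X \<times> UNIV \<and> length w \<le> n}"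
  proof
    fix g assume g: "g \<in> {g \<in> carrier G. word_length G X g \<le> n}"
    then obtain w where "w \<in> words X" "word_value G w = g" "length w = word_length G X g"
      using word_length_word by blast
    then show "g \<in> word_value G ` {w. set w \<subseteq> X \<times> UNIV \<and> length w \<le> n}"
      using g by (auto simp: words_def lists_eq_set)
  qed
  show "finite (word_value G ` {w. set w \<subseteq> X \<times> (UNIV :: bool set) \<and> length w \<le> n})"
    using assms by (intro finite_imageI finite_lists_length_le) simp
qed

end
end

section \<open>Cyclic subgroups of finite index and transfer\<close>

context group
begin

lemma commutant_sym: "x \<in> carrier G \<Longrightarrow> y \<in> commutant G x \<Longrightarrow> x \<in> commutant G y"
  by (simp add: commutant_def)

lemma int_pow_commutant:
  assumes "x \<in> carrier G" "y \<in> commutant G x"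
  shows "y [^] (k::int) \<in> commutant G x"
proof -
  interpret H: subgroup "commutant G x" G using assms by (intro subgroup_commutant)
  have "group (G\<lparr>carrier := commutant G x\<rparr>)" by (rule H.subgroup_is_group) (rule is_group)
  from group.int_pow_closed[OF this] show ?thesis
    using assms int_pow_consistent[OF H.subgroup_axioms] by simp
qed

lemma conjugate_int_pow:
  assumes "x \<in> carrier G" "y \<in> carrier G"
  shows "(y \<otimes> x \<otimes> inv y) [^] (k::int) = y \<otimes> x [^] k \<otimes> inv y"
proof -
  have "(\<lambda>g. y \<otimes> g \<otimes> inv y) \<in> hom G G"
    using assms by (auto simp: hom_def m_assoc) (metis inv_closed l_inv l_one m_assoc m_closed)
  then interpret h: group_hom G G "\<lambda>g. y \<otimes> g \<otimes> inv y" by unfold_locales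
  show ?thesis using h.hom_int_pow[OF assms(1), of k] by simp
qed

lemma torsion_free_int_pow:
  assumes "torsion_free G" "x \<in> carrier G" "x [^] (k::int) = \<one>" "k \<noteq> 0"
  shows "x = \<one>"
proof -
  have "x [^] nat \<bar>k\<bar> = \<one>"
    using assms int_pow_neg[of x k] by (auto simp: abs_if simp flip: int_pow_int)
  then show ?thesis using assms unfolding torsion_free_def by (metis nat_0_less_mult_iff zero_less_abs_iff zero_less_nat_eq)
qed

lemma torsion_free_int_pow_inject:
  assumes "torsion_free G" "x \<in> carrier G" "x \<noteq> \<one>" "x [^] (i::int) = x [^] (j::int)"
  shows "i = j"
proof (rule ccontr)
  assume "i \<noteq> j"
  moreover have "x [^] (i - j) = \<one>" using assms by (simp add: int_pow_diff)
  ultimately show False using torsion_free_int_pow[OF assms(1,2), of "i - j"] assms(3) by simp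
qed

text \<open>\<open>cover\<close> expresses that the powers of \<open>u\<close> have finite index in
  the centralizer of \<open>u\<close>. By pigeonhole, two powers of \<open>z\<close> have the same
  representative in \<open>B\<close>.\<close>

lemma power_in_cyclic_if_finite_index:
  assumes u: "u \<in> carrier G" and B: "finite B"
    and cover: "\<And>z. z \<in> commutant G u \<Longrightarrow> \<exists>k::int. u [^] k \<otimes> z \<in> B"
    and z: "z \<in> commutant G u"
  obtains a b :: int where "0 < a" "z [^] a = u [^] b"
proof -
  have zG: "z \<in> carrier G" using z by (simp add: commutant_def)
  have zk: "z [^] k \<in> commutant G u" for k :: int by (rule int_pow_commutant[OF u z])
  obtain e :: "int \<Rightarrow> int" where e: "\<And>i. u [^] e i \<otimes> z [^] i \<in> B"
    using cover[OF zk] by metis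
  define f where "f n = u [^] e (int n) \<otimes> z [^] int n" for n :: nat
  have "range f \<subseteq> B" using e by (auto simp: f_def)
  then have "finite (range f)" using B finite_subset by blast
  then have "\<not> inj f" using finite_imageD[of f UNIV] infinite_UNIV_nat by blast
  then obtain m n where "f m = f n" "m \<noteq> n" by (auto simp: inj_def)
  then obtain m n where mn: "m < n" "f m = f n" by (metis linorder_neqE_nat)
  have "z [^] (int n - int m) = inv (u [^] e n) \<otimes> f n \<otimes> inv (z [^] int m)"
    using zG u by (simp add: int_pow_diff f_def flip: m_assoc)
  also have "\<dots> = inv (u [^] e n) \<otimes> f m \<otimes> inv (z [^] int m)" by (simp add: mn)
  also have "\<dots> = u [^] (- e n) \<otimes> u [^] e m"
    using zG u by (simp add: f_def int_pow_neg m_assoc)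
  also have "\<dots> = u [^] (- e n + e m)" using u by (simp only: int_pow_mult)
  finally show thesis using that[of "int n - int m"] mn by simp
qed

text \<open>The transfer into the central subgroup generated by \<open>u\<close> is an injective homomorphism to \<open>\<int>\<close>.\<close>

lemma commutant_commute_if_finite_index:
  assumes tf: "torsion_free G" and u: "u \<in> carrier G" "u \<noteq> \<one>" and B: "finite B"
    and cover: "\<And>z. z \<in> commutant G u \<Longrightarrow> \<exists>k::int. u [^] k \<otimes> z \<in> B"
    and zw: "z \<in> commutant G u" "w \<in> commutant G u"
  shows "z \<otimes> w = w \<otimes> z"
proof -
  define C where "C = commutant G u"
  interpret C: subgroup C G unfolding C_def using u by (intro subgroup_commutant)
  have uC: "u [^] k \<in> C" for k :: int
    unfolding C_def using u by (intro int_pow_commutant) (auto simp: commutant_def)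
  have comm: "u [^] k \<otimes> c = c \<otimes> u [^] k" if "c \<in> C" for c and k :: int
  proof -
    have "u \<in> commutant G c" using commutant_sym[OF u(1)] that by (simp add: C_def)
    then have "u [^] k \<in> commutant G c" using that by (intro int_pow_commutant) auto
    then show ?thesis by (simp add: commutant_def)
  qed
  define coset where "coset c r \<longleftrightarrow> r \<in> B \<and> (\<exists>k::int. r = u [^] k \<otimes> c)" for c r
  define rep where "rep c = (SOME r. coset c r)" for c
  have "coset c (rep c)" if "c \<in> C" for c
    unfolding rep_def by (rule someI_ex) (use cover that in \<open>auto simp: coset_def C_def\<close>)
  then have rep_B: "rep c \<in> B" and rep_ex: "\<exists>k::int. rep c = u [^] k \<otimes> c" if "c \<in> C" for c
    using that by (auto simp: coset_def)
  have rep_shift: "rep (u [^] j \<otimes> c) = rep c" if c: "c \<in> C" for c and j :: int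
  proof -
    have shift: "u [^] k \<otimes> (u [^] j \<otimes> c) = u [^] (k + j) \<otimes> c" for k
      using u c by (simp add: int_pow_mult m_assoc)
    have ex: "(\<exists>k. P (k + j)) \<longleftrightarrow> (\<exists>k. P k)" for P :: "int \<Rightarrow> bool" by (metis diff_add_cancel)
    have "(\<exists>k::int. r = u [^] k \<otimes> (u [^] j \<otimes> c)) \<longleftrightarrow> (\<exists>k::int. r = u [^] k \<otimes> c)" for r
      unfolding shift by (rule ex[of "\<lambda>k. r = u [^] k \<otimes> c"])
    \<comment> \<open>The predicates agree for all members of a coset, so the choice of
      \<open>rep\<close> depends on the coset only.\<close>
    then have "coset (u [^] j \<otimes> c) = coset c" by (simp add: coset_def fun_eq_iff)
    then show ?thesis by (simp add: rep_def)
  qed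
  have "\<exists>k::int. c = u [^] k \<otimes> rep c" if c: "c \<in> C" for c
  proof -
    obtain k where k: "rep c = u [^] (k::int) \<otimes> c" using rep_ex[OF c] by blast
    have "c = (u [^] (- k) \<otimes> u [^] k) \<otimes> c" using u c by (simp flip: int_pow_mult)
    then show ?thesis using u c by (metis k m_assoc int_pow_closed C.mem_carrier)
  qed
  \<comment> \<open>\<open>e c\<close> is the position of \<open>c\<close> in its coset relative to
    the representative; it is unique because \<open>u\<close> has infinite order.\<close>
  then obtain e :: "'a \<Rightarrow> int" where e: "\<And>c. c \<in> C \<Longrightarrow> c = u [^] e c \<otimes> rep c" by metis
  have repC: "rep c \<in> C" if c: "c \<in> C" for c
    using rep_ex[OF c] uC c by auto
  have rep_rep: "rep (rep c) = rep c" if "c \<in> C" for c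
    using rep_ex[OF that] rep_shift[OF that] by metis
  have e_shift: "e (u [^] j \<otimes> c) = j + e c" if c: "c \<in> C" for c and j :: int
  proof -
    have "u [^] e (u [^] j \<otimes> c) \<otimes> rep c = u [^] j \<otimes> c"
      using e[of "u [^] j \<otimes> c"] uC c rep_shift by simp
    also have "\<dots> = u [^] (j + e c) \<otimes> rep c"
      using e[OF c] u repC[OF c] by (metis int_pow_mult m_assoc int_pow_closed C.mem_carrier)
    finally have "u [^] e (u [^] j \<otimes> c) = u [^] (j + e c)" using u repC[OF c] by simp
    then show ?thesis by (rule torsion_free_int_pow_inject[OF tf u])
  qed
  define R where "R = rep ` C"
  have "R \<subseteq> B" using rep_B by (auto simp: R_def)
  then have R: "finite R" "R \<subseteq> C" "\<one> \<in> C"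
    using finite_subset[OF _ B] repC by (auto simp: R_def)
  have rep_R: "rep r = r" if "r \<in> R" for r using that rep_rep by (auto simp: R_def)
  \<comment> \<open>The transfer: the sum of the exponents picked up when \<open>g\<close>
    multiplies the representatives.\<close>
  define T where "T g = (\<Sum>r\<in>R. e (g \<otimes> r))" for g
  have T_mult: "T (g \<otimes> h) = T g + T h" if g: "g \<in> C" and h: "h \<in> C" for g h
  proof -
    \<comment> \<open>Left multiplication by \<open>h\<close> permutes the finitely many cosets,
      since \<open>h\<close> commutes with the powers of \<open>u\<close>.\<close>
    have "inj_on (\<lambda>r. rep (h \<otimes> r)) R"
    proof
      fix r s assume r: "r \<in> R" and s: "s \<in> R" and eq: "rep (h \<otimes> r) = rep (h \<otimes> s)"
      have rs: "r \<in> C" "s \<in> C" using r s R by auto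
      obtain j k :: int where "rep (h \<otimes> r) = u [^] j \<otimes> (h \<otimes> r)" "rep (h \<otimes> s) = u [^] k \<otimes> (h \<otimes> s)"
        using rep_ex[of "h \<otimes> r"] rep_ex[of "h \<otimes> s"] rs h by auto
      then have "h \<otimes> (u [^] j \<otimes> r) = h \<otimes> (u [^] k \<otimes> s)"
        using eq comm[OF h] h rs u by (metis C.mem_carrier int_pow_closed m_assoc)
      then have "u [^] j \<otimes> r = u [^] k \<otimes> s" using h rs u by simp
      then have "rep r = rep s" using rep_shift rs by metis
      then show "r = s" using rep_R r s by simp
    qed
    moreover have "(\<lambda>r. rep (h \<otimes> r)) ` R \<subseteq> R" using R h by (auto simp: R_def)
    ultimately have bij: "bij_betw (\<lambda>r. rep (h \<otimes> r)) R R"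
      using R(1) by (simp add: bij_betw_def endo_inj_surj)
    have "e (g \<otimes> h \<otimes> r) = e (h \<otimes> r) + e (g \<otimes> rep (h \<otimes> r))" if "r \<in> R" for r
    proof -
      have r: "h \<otimes> r \<in> C" using that R h by auto
      have "g \<otimes> h \<otimes> r = g \<otimes> (u [^] e (h \<otimes> r) \<otimes> rep (h \<otimes> r))"
        using e[OF r] g h r that R by (metis C.mem_carrier m_assoc subsetD)
      also have "\<dots> = u [^] e (h \<otimes> r) \<otimes> (g \<otimes> rep (h \<otimes> r))"
        using comm[OF g] g u repC[OF r] by (metis C.mem_carrier int_pow_closed m_assoc)
      finally show ?thesis using e_shift[of "g \<otimes> rep (h \<otimes> r)" "e (h \<otimes> r)"] g repC[OF r] by simp
    qed
    then have "T (g \<otimes> h) = T h + (\<Sum>r\<in>R. e (g \<otimes> rep (h \<otimes> r)))"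
      by (simp add: T_def sum.distrib)
    also have "(\<Sum>r\<in>R. e (g \<otimes> rep (h \<otimes> r))) = T g"
      unfolding T_def by (rule sum.reindex_bij_betw[OF bij])
    finally show ?thesis by simp
  qed
  have "T \<one> = 0" using T_mult[of \<one> \<one>] by simp
  then have T_pow: "T (u [^] j) = j * int (card R)" for j :: int
  proof -
    have "T (u [^] j) = (\<Sum>r\<in>R. j + e (\<one> \<otimes> r))"
      unfolding T_def using R e_shift by (intro sum.cong) auto
    also have "\<dots> = j * int (card R) + T \<one>" by (simp add: sum.distrib T_def)
    finally show ?thesis using \<open>T \<one> = 0\<close> by simp
  qed
  have T_int_pow: "T (g [^] int n) = int n * T g" if "g \<in> C" for g n
  proof (induction n)
    case 0
    then show ?case using \<open>T \<one> = 0\<close> by simp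
  next
    case (Suc n)
    have "g [^] int n \<in> C" using int_pow_commutant[OF u(1)] that by (simp add: C_def)
    moreover have "g [^] int (Suc n) = g [^] int n \<otimes> g" by (simp only: int_pow_int nat_pow_Suc)
    ultimately have "T (g [^] int (Suc n)) = int n * T g + T g" using T_mult that by (simp only: Suc)
    then show ?case by (simp add: algebra_simps)
  qed
  have T_inj: "g = \<one>" if g: "g \<in> C" and "T g = 0" for g
  proof -
    \<comment> \<open>Some power of \<open>g\<close> is a power of \<open>u\<close>, on which
      \<open>T\<close> multiplies the exponent by the index; so a vanishing \<open>T g\<close> makes
      \<open>g\<close> a torsion element.\<close>
    obtain a b :: int where ab: "0 < a" "g [^] a = u [^] b"
      using power_in_cyclic_if_finite_index[OF u(1) B cover] g C_def by metis
    then have "b * int (card R) = 0"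
      using T_int_pow[OF g, of "nat a"] T_pow[of b] \<open>T g = 0\<close> by simp
    moreover have "R \<noteq> {}" using g by (auto simp: R_def)
    ultimately have "g [^] a = \<one>" using R(1) ab by simp
    then show ?thesis using torsion_free_int_pow[OF tf] g ab by auto
  qed
  have zw': "z \<in> C" "w \<in> C" using zw by (auto simp: C_def)
  \<comment> \<open>With values in an abelian group, \<open>T\<close> kills the commutator
    \<open>inv (w \<otimes> z) \<otimes> (z \<otimes> w)\<close>.\<close>
  have "T (inv (w \<otimes> z)) + T (w \<otimes> z) = 0"
    using T_mult[of "inv (w \<otimes> z)" "w \<otimes> z"] zw' \<open>T \<one> = 0\<close> by simp
  then have "T (inv (w \<otimes> z) \<otimes> (z \<otimes> w)) = 0"
    using T_mult zw' by simp
  then have "inv (w \<otimes> z) \<otimes> (z \<otimes> w) = \<one>" using T_inj zw' by simp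
  then show ?thesis using zw' by (metis C.mem_carrier inv_closed inv_equality inv_inv m_closed)
qed

end

section \<open>Hyperbolic length functions and loxodromic elements\<close>

text \<open>What is used of the word length: \<open>len_split\<close> is a discrete form of
  geodesicity, \<open>finite_ball\<close> is properness, and \<open>four_point_len\<close> is
  Gromov's inequality without division, hence the factor 2.\<close>

locale hyperbolic_length = group G for G :: "('a, 'm) monoid_scheme" (structure) +
  fixes len :: "'a \<Rightarrow> nat" and \<delta> :: real
  assumes len_one [simp]: "len \<one> = 0"
    and len_inv [simp]: "g \<in> carrier G \<Longrightarrow> len (inv g) = len g"
    and len_mult: "\<lbrakk>g \<in> carrier G; h \<in> carrier G\<rbrakk> \<Longrightarrow> len (g \<otimes> h) \<le> len g + len h"
    and len_split: "\<lbrakk>g \<in> carrier G; n \<le> len g\<rbrakk>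
      \<Longrightarrow> \<exists>c\<in>carrier G. len c \<le> n \<and> len (inv c \<otimes> g) \<le> len g - n"
    and finite_ball: "finite {g \<in> carrier G. len g \<le> n}"
    and delta_nonneg: "0 \<le> \<delta>"
    and four_point_len: "\<lbrakk>x \<in> carrier G; y \<in> carrier G; z \<in> carrier G; t \<in> carrier G\<rbrakk>
      \<Longrightarrow> real (len (inv x \<otimes> z)) + real (len (inv y \<otimes> t))
        \<le> max (real (len (inv x \<otimes> y)) + real (len (inv z \<otimes> t)))
            (real (len (inv y \<otimes> z)) + real (len (inv x \<otimes> t))) + 2 * \<delta>"
begin

definition dist_len :: "'a \<Rightarrow> 'a \<Rightarrow> real" where
  "dist_len x y = real (len (inv x \<otimes> y))"

lemma four_point:
  assumes "x \<in> carrier G" "y \<in> carrier G" "z \<in> carrier G" "t \<in> carrier G"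
  shows "dist_len x z + dist_len y t
    \<le> max (dist_len x y + dist_len z t) (dist_len y z + dist_len x t) + 2 * \<delta>"
  unfolding dist_len_def by (rule four_point_len[OF assms])

lemma dist_len_translate:
  assumes "k \<in> carrier G" "x \<in> carrier G" "y \<in> carrier G"
  shows "dist_len (k \<otimes> x) (k \<otimes> y) = dist_len x y"
proof -
  have "inv (k \<otimes> x) \<otimes> (k \<otimes> y) = inv x \<otimes> ((inv k \<otimes> k) \<otimes> y)"
    using assms by (simp only: inv_mult_group m_assoc m_closed inv_closed)
  then show ?thesis using assms by (simp add: dist_len_def)
qed

lemma dist_len_one: "x \<in> carrier G \<Longrightarrow> dist_len \<one> x = real (len x)"
  by (simp add: dist_len_def)

lemma dist_len_sym:
  assumes "x \<in> carrier G" "y \<in> carrier G"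
  shows "dist_len x y = dist_len y x"
  using len_inv[of "inv x \<otimes> y"] assms by (simp add: dist_len_def inv_mult_group)

lemma dist_len_pow:
  assumes "x \<in> carrier G"
  shows "dist_len (x [^] m) (x [^] (m + n)) = real (len (x [^] (n::nat)))"
  using dist_len_translate[of "x [^] m" \<one> "x [^] n"] assms
  by (simp add: nat_pow_mult dist_len_one)

text \<open>Growth at the first doubling propagates: in the four-point inequality for \<one>,
  \<open>z\<close> and its powers with exponents 2 and \<open>n + 2\<close>, the first alternative
  would contradict the growth from exponent \<open>n\<close> to \<open>n + 1\<close>.\<close>

lemma len_pow_growth:
  assumes z: "z \<in> carrier G" and "0 < \<epsilon>" and growth: "real (len z) + 2 * \<delta> + \<epsilon> \<le> real (len (z [^] (2::nat)))"
  shows "real (len (z [^] n)) + \<epsilon> \<le> real (len (z [^] Suc n))"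
proof (induction n)
  case 0
  have "z [^] (2::nat) = z \<otimes> z" using z by (simp add: numeral_2_eq_2)
  then have "len (z [^] (2::nat)) \<le> len z + len z" using len_mult[OF z z] by simp
  then show ?case using growth delta_nonneg z by simp
next
  case (Suc n)
  let ?l = "\<lambda>n. real (len (z [^] (n::nat)))"
  have l1: "?l 1 = real (len z)" using z by simp
  have "dist_len (z [^] (0::nat)) (z [^] (2::nat)) + dist_len (z [^] (1::nat)) (z [^] Suc (Suc n))
    \<le> max (dist_len (z [^] (0::nat)) (z [^] (1::nat)) + dist_len (z [^] (2::nat)) (z [^] Suc (Suc n)))
       (dist_len (z [^] (1::nat)) (z [^] (2::nat)) + dist_len (z [^] (0::nat)) (z [^] Suc (Suc n))) + 2 * \<delta>"
    by (intro four_point) (use z in auto)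
  then have "?l 2 + ?l (Suc n) \<le> max (?l 1 + ?l n) (?l 1 + ?l (Suc (Suc n))) + 2 * \<delta>"
    using dist_len_pow[OF z, of 0 2] dist_len_pow[OF z, of 1 "Suc n"] dist_len_pow[OF z, of 0 1]
      dist_len_pow[OF z, of 2 n] dist_len_pow[OF z, of 1 1] dist_len_pow[OF z, of 0 "Suc (Suc n)"]
    by (simp only: add_0 plus_1_eq_Suc add_2_eq_Suc one_add_one Suc_1)
  then show ?case using Suc growth \<open>0 < \<epsilon>\<close> l1 by linarith
qed

text \<open>Suppose doubling an exponent never gains more than \<open>2 * \<delta>\<close>. Take the
  longest power \<open>g\<close> with exponent at most \<open>N\<close>: the midpoint
  \<open>c\<close> of \<one> and \<open>g\<close> is moved only by \<open>K\<close> under all powers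
  up to \<open>N\<close>. Conjugation by \<open>c\<close> thus puts \<open>N + 1\<close> distinct
  powers into a ball of \<open>N\<close> elements.\<close>

lemma exists_power_growth:
  assumes tf: "torsion_free G" and x: "x \<in> carrier G" "x \<noteq> \<one>"
  obtains k :: nat where "0 < k" "real (len (x [^] k)) + 2 * \<delta> < real (len (x [^] (2 * k)))"
proof (rule ccontr)
  assume "\<not> thesis"
  let ?l = "\<lambda>n. real (len (x [^] (n::nat)))"
  have slow: "?l (2 * k) \<le> ?l k + 2 * \<delta>" for k
  proof (cases "k = 0")
    case False
    then show ?thesis using that[of k] \<open>\<not> thesis\<close> by linarith
  qed (simp add: delta_nonneg)
  \<comment> \<open>The sum of the errors below: \<open>?l 1\<close> pays for odd exponents, the
    multiples of \<delta> for the four-point inequalities, and 1 covers the rounding of the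
    midpoint.\<close>
  define K where "K = ?l 1 + 6 * \<delta> + 1"
  define B where "B = {g \<in> carrier G. len g \<le> nat \<lfloor>K\<rfloor>}"
  define N where "N = card B"
  obtain i where i: "i \<le> N" and i_max: "\<And>j. j \<le> N \<Longrightarrow> len (x [^] j) \<le> len (x [^] i)"
    using ex_has_greatest_nat[of "\<lambda>i. i \<le> N" 0 "\<lambda>i. len (x [^] i)" "Suc (Max ((\<lambda>i. len (x [^] i)) ` {..N}))"]
    by (auto simp: less_Suc_eq_le)
  define g L where "g = x [^] i" and "L = ?l i"
  \<comment> \<open>Exponents up to \<open>2 * N\<close> occur because \<open>h \<otimes> g\<close>
    is the power with exponent \<open>i + j\<close>.\<close>
  have l_upper: "?l n \<le> L + ?l 1 + 2 * \<delta>" if "n \<le> 2 * N" for n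
  proof (cases "even n")
    case True
    then show ?thesis using slow[of "n div 2"] i_max[of "n div 2"] that by (auto simp: L_def)
  next
    case False
    define k where "k = n div 2"
    have n: "n = 2 * k + 1" "k \<le> N" using False that by (auto simp: k_def)
    have "?l n \<le> ?l (2 * k) + ?l 1"
      using len_mult[of "x [^] (2 * k)" "x [^] (1::nat)"] x n(1) nat_pow_mult[of x "2 * k" 1]
      by (simp del: nat_pow_Suc One_nat_def)
    then show ?thesis using slow[of k] i_max[of k] n(2) by (simp add: L_def)
  qed
  obtain c where c: "c \<in> carrier G" "len c \<le> len g div 2" "len (inv c \<otimes> g) \<le> len g - len g div 2"
    using len_split[of g "len g div 2"] x by (auto simp: g_def)
  have g: "g \<in> carrier G" "real (len g) = L" using x by (auto simp: g_def L_def)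
  have "real (len c) \<le> L / 2" "real (len (inv c \<otimes> g)) \<le> L / 2 + 1 / 2" using c(2,3) g(2) by linarith+
  then have c1: "dist_len c \<one> \<le> L / 2" and cg: "dist_len c g \<le> L / 2 + 1 / 2"
    using c by (simp_all add: dist_len_def)
  text \<open>In a tree, the midpoint \<open>c\<close> would be fixed by all the powers considered.\<close>
  have c_near: "dist_len c p \<le> max (dist_len p g) (dist_len \<one> p) - L / 2 + 1 / 2 + 2 * \<delta>"
    if p: "p \<in> carrier G" for p
  proof -
    have "dist_len c p + dist_len \<one> g \<le> max (dist_len c \<one> + dist_len p g) (dist_len \<one> p + dist_len c g) + 2 * \<delta>"
      by (rule four_point) (use c g p in auto)
    then show ?thesis using c1 cg dist_len_one[OF g(1)] g(2) by linarith
  qed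
  have moved: "dist_len c (x [^] j \<otimes> c) \<le> K" if "j \<le> N" for j
  proof -
    define h where "h = x [^] j"
    have h: "h \<in> carrier G" "dist_len \<one> h \<le> L"
      using x i_max[OF that] by (auto simp: h_def dist_len_one L_def)
    have hg: "h \<otimes> g = x [^] (i + j)" using x by (simp add: h_def g_def nat_pow_mult add.commute)
    have "dist_len h g \<le> L"
    proof (cases "i \<le> j")
      case True
      then show ?thesis
        using dist_len_pow[OF x(1), of i "j - i"] i_max[of "j - i"] that dist_len_sym[OF h(1) g(1)]
        by (simp add: h_def g_def L_def)
    next
      case False
      then show ?thesis
        using dist_len_pow[OF x(1), of j "i - j"] i_max[of "i - j"] i by (simp add: h_def g_def L_def)
    qed
    then have ch: "dist_len c h \<le> L / 2 + 1 / 2 + 2 * \<delta>" using c_near[OF h(1)] h(2) by linarith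
    have "dist_len (h \<otimes> g) g \<le> L"
      using dist_len_pow[OF x(1), of i j] i_max[OF that] dist_len_sym[of "h \<otimes> g" g] h(1) g(1)
      by (simp add: hg[unfolded g_def] L_def g_def x(1))
    moreover have "dist_len \<one> (h \<otimes> g) \<le> L + ?l 1 + 2 * \<delta>"
      using l_upper[of "i + j"] i that x by (simp add: hg dist_len_one)
    ultimately have chg: "dist_len c (h \<otimes> g) \<le> L / 2 + ?l 1 + 1 / 2 + 4 * \<delta>"
      using c_near[of "h \<otimes> g"] h(1) g(1) delta_nonneg by simp
    \<comment> \<open>\<open>h \<otimes> c\<close> is the midpoint of \<open>h\<close> and
      \<open>h \<otimes> g\<close>, and \<open>c\<close> is at distance about \<open>L / 2\<close>
      from both; the two therefore nearly coincide.\<close>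
    have "dist_len (h \<otimes> c) c + dist_len h (h \<otimes> g)
      \<le> max (dist_len (h \<otimes> c) h + dist_len c (h \<otimes> g)) (dist_len h c + dist_len (h \<otimes> c) (h \<otimes> g)) + 2 * \<delta>"
      by (rule four_point) (use c g h in auto)
    moreover have "dist_len h (h \<otimes> g) = L" "dist_len (h \<otimes> c) h = dist_len c \<one>"
      "dist_len (h \<otimes> c) (h \<otimes> g) = dist_len c g"
      using dist_len_translate[of h \<one> g] dist_len_translate[of h c \<one>] dist_len_translate[of h c g]
        h g c by (simp_all add: dist_len_one)
    ultimately have "dist_len (h \<otimes> c) c \<le> K"
      using ch chg c1 cg dist_len_sym[OF h(1) c(1)] delta_nonneg by (simp add: K_def)
    then show ?thesis using dist_len_sym[of "h \<otimes> c" c] h c by (simp add: h_def)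
  qed
  have "(\<lambda>j. inv c \<otimes> (x [^] j \<otimes> c)) ` {..N} \<subseteq> B"
  proof
    fix b assume "b \<in> (\<lambda>j. inv c \<otimes> (x [^] j \<otimes> c)) ` {..N}"
    then obtain j where j: "j \<le> N" "b = inv c \<otimes> (x [^] j \<otimes> c)" by auto
    then have "len b \<le> nat \<lfloor>K\<rfloor>" using moved[OF j(1)] by (simp add: dist_len_def le_nat_floor)
    then show "b \<in> B" using j c x by (simp add: B_def)
  qed
  moreover have "inj_on (\<lambda>j. inv c \<otimes> (x [^] j \<otimes> c)) {..N}"
  proof
    fix i j :: nat assume "inv c \<otimes> (x [^] i \<otimes> c) = inv c \<otimes> (x [^] j \<otimes> c)"
    then have "x [^] i = x [^] j" using c x by simp
    then show "i = j"
      using torsion_free_int_pow_inject[OF tf x, of "int i" "int j"] by (simp add: int_pow_int)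
  qed
  moreover have "finite B" by (simp add: B_def finite_ball)
  ultimately have "card {..N} \<le> card B" by (metis card_image card_mono)
  then show False by (simp add: N_def)
qed

text \<open>The gain \<open>2 * \<delta>\<close> absorbs the error of one four-point inequality; the
  extra 1 makes the comparison strict and the growth linear even for \<delta> equal to 0.\<close>

definition loxodromic :: "'a \<Rightarrow> bool" where
  "loxodromic u \<longleftrightarrow> u \<in> carrier G
    \<and> (\<forall>n::nat. real (len (u [^] n)) + 2 * \<delta> + 1 \<le> real (len (u [^] Suc n)))"

text \<open>The gain \<epsilon> per step may be small; passing to the power with exponent
  \<open>t\<close> multiplies it by \<open>t\<close>.\<close>

lemma exists_loxodromic_power:
  assumes tf: "torsion_free G" and x: "x \<in> carrier G" "x \<noteq> \<one>"
  obtains k :: nat where "0 < k" "loxodromic (x [^] k)"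
proof -
  obtain k :: nat where k: "0 < k" "real (len (x [^] k)) + 2 * \<delta> < real (len (x [^] (2 * k)))"
    using exists_power_growth[OF assms] .
  define z where "z = x [^] k"
  have z: "z \<in> carrier G" using x by (simp add: z_def)
  define \<epsilon> where "\<epsilon> = real (len (z [^] (2::nat))) - (real (len z) + 2 * \<delta>)"
  have "z [^] (2::nat) = x [^] (2 * k)" using x by (simp add: z_def nat_pow_pow mult.commute)
  then have "0 < \<epsilon>" using k by (simp add: \<epsilon>_def z_def)
  have step: "real (len (z [^] n)) + \<epsilon> \<le> real (len (z [^] Suc n))" for n
    by (rule len_pow_growth[OF z \<open>0 < \<epsilon>\<close>]) (simp add: \<epsilon>_def)
  have growth: "real (len (z [^] n)) + real t * \<epsilon> \<le> real (len (z [^] (n + t)))" for n t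
  proof (induction t)
    case (Suc t)
    then show ?case using step[of "n + t"] by (simp add: algebra_simps)
  qed simp
  obtain t where t: "(2 * \<delta> + 1) / \<epsilon> < real t" using reals_Archimedean2 by blast
  then have t\<epsilon>: "2 * \<delta> + 1 \<le> real t * \<epsilon>" using \<open>0 < \<epsilon>\<close> by (simp add: field_simps)
  have "t \<noteq> 0" using t\<epsilon> delta_nonneg by (intro notI) simp
  have "real (len (z [^] (t * n))) + 2 * \<delta> + 1 \<le> real (len (z [^] (t * Suc n)))" for n
    using growth[of "t * n" t] t\<epsilon> by (simp add: add.commute)
  then have "loxodromic (z [^] t)" unfolding loxodromic_def using z by (simp only: nat_pow_pow nat_pow_closed) simp
  then show thesis using that[of "k * t"] \<open>t \<noteq> 0\<close> k(1) x by (simp add: z_def nat_pow_pow)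
qed

context
  fixes u assumes lox: "loxodromic u"
begin

lemma loxodromic_closed: "u \<in> carrier G"
  using lox by (simp add: loxodromic_def)

lemma loxodromic_growth: "real (len (u [^] m)) + real n * (2 * \<delta> + 1) \<le> real (len (u [^] (m + n)))"
proof (induction n)
  case (Suc n)
  have "real (len (u [^] (m + n))) + 2 * \<delta> + 1 \<le> real (len (u [^] Suc (m + n)))"
    using lox unfolding loxodromic_def by blast
  then show ?case using Suc by (simp add: algebra_simps)
qed simp

lemma loxodromic_inv: "loxodromic (inv u)"
proof -
  have "len (inv u [^] n) = len (u [^] n)" for n :: nat
    using loxodromic_closed by (simp add: nat_pow_inv)
  then show ?thesis using lox unfolding loxodromic_def by (simp only: inv_closed simp_thms)
qed

text \<open>If \<open>z\<close> is no closer to \<open>u\<close> than to \<one>, it lies behind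
  \<one> on the quasi-axis of \<open>u\<close>, and its distance to a forward power is additive up
  to a constant. In the four-point inequality for \<open>z\<close>, \<one>, \<open>u\<close> and the
  power, the extra 1 in \<open>loxodromic\<close> excludes the other alternative.\<close>

lemma loxodromic_projection:
  assumes z: "z \<in> carrier G" and "len z \<le> len (inv u \<otimes> z)"
  shows "real (len z) + real (len (u [^] i)) - real (len u) - 2 * \<delta> \<le> real (len (inv (u [^] (i::nat)) \<otimes> z))"
proof (cases i)
  case 0
  then show ?thesis using z delta_nonneg by simp
next
  case (Suc m)
  note u = loxodromic_closed
  have "dist_len z u + dist_len \<one> (u [^] i)
    \<le> max (dist_len z \<one> + dist_len u (u [^] i)) (dist_len \<one> u + dist_len z (u [^] i)) + 2 * \<delta>"
    by (rule four_point) (use u z in auto)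
  moreover have "dist_len u (u [^] i) = real (len (u [^] m))"
    using dist_len_pow[OF u, of 1 m] u by (simp add: Suc del: nat_pow_Suc)
  moreover have "real (len (u [^] m)) + 2 * \<delta> + 1 \<le> real (len (u [^] i))"
    using lox unfolding loxodromic_def Suc by blast
  moreover have "dist_len z u = real (len (inv u \<otimes> z))" "dist_len z \<one> = real (len z)"
    "dist_len z (u [^] i) = real (len (inv (u [^] i) \<otimes> z))"
    using u z dist_len_sym[of z u] dist_len_sym[of z \<one>] dist_len_sym[of z "u [^] i"]
    by (auto simp: dist_len_def)
  ultimately show ?thesis using assms(2) u by (simp add: dist_len_one)
qed

end

text \<open>In the quadrilateral \<one>, \<open>v\<close>, \<open>v \<otimes> z\<close>,
  \<open>z\<close>, opposite sides have the lengths of \<open>v\<close> and \<open>z\<close>, while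
  both diagonals are almost as long as these together. So one of the two lengths is small, and
  \<open>v\<close> was chosen long.\<close>

lemma loxodromic_commutant_short:
  assumes lox: "loxodromic u" and z: "z \<in> commutant G u"
    and min: "len z \<le> len (u \<otimes> z)" "len z \<le> len (inv u \<otimes> z)"
  shows "real (len z) \<le> real (len u) + 3 * \<delta>"
proof -
  have u: "u \<in> carrier G" and zG: "z \<in> carrier G" and uz: "u \<otimes> z = z \<otimes> u"
    using lox z by (auto simp: loxodromic_def commutant_def)
  obtain i where i: "real (len u) + 3 * \<delta> < real i" using reals_Archimedean2 by blast
  define v where "v = u [^] i"
  have v: "v \<in> carrier G" and vz: "v \<otimes> z = z \<otimes> v"
    using group_commutes_pow[OF uz u zG, of i] u by (auto simp: v_def)
  have "real i * 1 \<le> real i * (2 * \<delta> + 1)" using delta_nonneg by (intro mult_left_mono) auto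
  then have "real (len u) + 3 * \<delta> < real (len v)"
    using loxodromic_growth[OF lox, of 0 i] i by (simp add: v_def)
  moreover have "real (len z) + real (len v) - real (len u) - 2 * \<delta> \<le> real (len (inv v \<otimes> z))"
    using loxodromic_projection[OF lox zG min(2)] by (simp add: v_def)
  moreover have "real (len z) + real (len v) - real (len u) - 2 * \<delta> \<le> real (len (v \<otimes> z))"
    using loxodromic_projection[OF loxodromic_inv[OF lox] zG, of i] min(1) u by (simp add: v_def nat_pow_inv)
  moreover have "dist_len \<one> (v \<otimes> z) + dist_len v z
      \<le> max (dist_len \<one> v + dist_len (v \<otimes> z) z) (dist_len v (v \<otimes> z) + dist_len \<one> z) + 2 * \<delta>"
    by (rule four_point) (use v zG in auto)
  moreover have "dist_len (v \<otimes> z) z = real (len v)" "dist_len v (v \<otimes> z) = real (len z)"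
    using dist_len_translate[of z v \<one>] dist_len_translate[of v \<one> z] dist_len_sym[of v \<one>] v zG
    by (simp_all add: vz dist_len_one)
  ultimately show ?thesis using v zG delta_nonneg by (simp add: dist_len_one dist_len_def)
qed

text \<open>A shortest element of the coset cannot be shortened by \<open>u\<close> or its inverse.
  So a fixed ball meets every coset, and the index is finite.\<close>

lemma loxodromic_commutant_cover:
  assumes lox: "loxodromic u" and z: "z \<in> commutant G u"
  shows "\<exists>k::int. u [^] k \<otimes> z \<in> {g \<in> carrier G. len g \<le> nat \<lfloor>real (len u) + 3 * \<delta>\<rfloor>}"
proof -
  have u: "u \<in> carrier G" and zG: "z \<in> carrier G"
    using lox z by (auto simp: loxodromic_def commutant_def)
  obtain k :: int where k: "\<And>j. len (u [^] k \<otimes> z) \<le> len (u [^] (j::int) \<otimes> z)"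
    using ex_has_least_nat[of "\<lambda>_. True" 0 "\<lambda>k::int. len (u [^] k \<otimes> z)"] by auto
  define w where "w = u [^] k \<otimes> z"
  have "u [^] k \<in> commutant G u" by (rule int_pow_commutant[OF u]) (simp add: commutant_def u)
  then have w: "w \<in> commutant G u" 
    unfolding w_def using z by (rule subgroup.m_closed[OF subgroup_commutant[OF u]])
  have "u \<otimes> w = u [^] (1 + k) \<otimes> z" "inv u \<otimes> w = u [^] (- 1 + k) \<otimes> z"
    using u zG int_pow_mult[OF u, of 1 k] int_pow_mult[OF u, of "- 1" k] int_pow_neg[OF u, of 1]
    by (simp_all add: w_def m_assoc)
  then have "real (len w) \<le> real (len u) + 3 * \<delta>"
    using k[of "1 + k"] k[of "- 1 + k"] by (intro loxodromic_commutant_short[OF lox w]) (simp_all add: w_def)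
  then have "len w \<le> nat \<lfloor>real (len u) + 3 * \<delta>\<rfloor>" by (rule le_nat_floor)
  then show ?thesis using u zG unfolding w_def by blast
qed

lemma loxodromic_not_one: "loxodromic u \<Longrightarrow> u \<noteq> \<one>"
  using loxodromic_growth[of u 0 1] delta_nonneg by auto

text \<open>The centralizer of \<open>x\<close> is contained in that of a loxodromic power of
  \<open>x\<close>, to which the transfer argument applies.\<close>

lemma centralizer_commute:
  assumes tf: "torsion_free G" and x: "x \<in> carrier G" "x \<noteq> \<one>"
    and yz: "y \<in> commutant G x" "z \<in> commutant G x"
  shows "y \<otimes> z = z \<otimes> y"
proof -
  obtain k :: nat where k: "loxodromic (x [^] k)"
    using exists_loxodromic_power[OF tf x] by metis
  have "y \<in> commutant G (x [^] k)" if "y \<in> commutant G x" for y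
    using that group_commutes_pow[of x y k] x by (auto simp: commutant_def)
  then show ?thesis
    using commutant_commute_if_finite_index[OF tf loxodromic_closed[OF k] loxodromic_not_one[OF k]
        finite_ball loxodromic_commutant_cover[OF k]] yz by blast
qed

text \<open>Conjugation by \<open>y\<close> changes lengths by at most \<open>2 * len y\<close>, so
  the powers of \<open>u\<close> with exponents \<open>a * n\<close> and \<open>b * n\<close> stay
  of comparable length for all \<open>n\<close>. Exponents of different absolute value would make
  the difference at least \<open>n\<close>.\<close>

lemma loxodromic_conjugate_power:
  assumes lox: "loxodromic u" and y: "y \<in> carrier G" and a: "0 < a"
    and conj: "y \<otimes> u [^] a \<otimes> inv y = u [^] (b::int)"
  shows "\<bar>b\<bar> = a"
proof -
  have u: "u \<in> carrier G" using lox by (simp add: loxodromic_def)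
  let ?l = "\<lambda>n. real (len (u [^] (n::nat)))"
  have close: "\<bar>?l (n * nat a) - ?l (n * nat \<bar>b\<bar>)\<bar> \<le> 2 * real (len y)" for n
  proof -
    define v w where "v = u [^] (a * int n)" and "w = u [^] (b * int n)"
    have vw: "v \<in> carrier G" "w \<in> carrier G" using u by (auto simp: v_def w_def)
    have eq: "y \<otimes> v \<otimes> inv y = w"
      using conjugate_int_pow[of "u [^] a" y "int n"] conj u y by (simp add: v_def w_def int_pow_pow)
    have "len w \<le> len y + len v + len y"
      using len_mult[of "y \<otimes> v" "inv y"] len_mult[of y v] y vw by (simp flip: eq)
    moreover have "len v \<le> len y + len w + len y"
    proof -
      have "v = inv y \<otimes> w \<otimes> y"
        using y vw by (simp flip: eq add: inv_solve_left inv_solve_right m_assoc)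
      then show ?thesis
        using len_mult[of "inv y \<otimes> w" y] len_mult[of "inv y" w] y vw by simp
    qed
    moreover have "len v = len (u [^] (n * nat a))"
    proof -
      have "a * int n = int (n * nat a)" using a by simp
      then show ?thesis by (simp only: v_def int_pow_int)
    qed
    moreover have "len w = len (u [^] (n * nat \<bar>b\<bar>))"
    proof (cases "0 \<le> b")
      case True
      then have "b * int n = int (n * nat \<bar>b\<bar>)" by simp
      then show ?thesis by (simp only: w_def int_pow_int)
    next
      case False
      then have "b * int n = - int (n * nat \<bar>b\<bar>)" by simp
      then have "w = inv (u [^] (n * nat \<bar>b\<bar>))" using u by (simp only: w_def int_pow_neg_int)
      then show ?thesis using u by simp
    qed
    ultimately show ?thesis by linarith
  qed
  have apart: "real n \<le> ?l (n * q) - ?l (n * p)" if "p < q" for n p q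
  proof -
    have "n \<le> n * (q - p)" using that by (cases "q - p") auto
    then have "real n \<le> real (n * (q - p)) * 1" by (simp only: of_nat_le_iff mult_1_right)
    also have "\<dots> \<le> real (n * (q - p)) * (2 * \<delta> + 1)"
      using delta_nonneg by (intro mult_left_mono) auto
    finally have "real n \<le> real (n * (q - p)) * (2 * \<delta> + 1)" .
    moreover have "n * p + n * (q - p) = n * q" using that by (simp flip: distrib_left)
    ultimately show ?thesis using loxodromic_growth[OF lox, of "n * p" "n * (q - p)"] by simp
  qed
  obtain n where n: "2 * real (len y) < real n" using reals_Archimedean2 by blast
  have "nat \<bar>b\<bar> = nat a"
  proof (rule ccontr)
    assume "nat \<bar>b\<bar> \<noteq> nat a"
    then consider "nat \<bar>b\<bar> < nat a" | "nat a < nat \<bar>b\<bar>" by linarith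
    then show False
      using apart[of "nat \<bar>b\<bar>" "nat a" n] apart[of "nat a" "nat \<bar>b\<bar>" n] close[of n] n by cases linarith+
  qed
  then show ?thesis using a by simp
qed

text \<open>Some power \<open>v\<close> of \<open>x\<close> is conjugated by \<open>y\<close> to
  itself or to its inverse. Either way \<open>y\<close> commutes with \<open>v\<close>, whose
  abelian centralizer also contains \<open>x\<close>.\<close>

lemma conjugate_commute:
  assumes tf: "torsion_free G" and x: "x \<in> carrier G" "x \<noteq> \<one>" and y: "y \<in> carrier G"
    and comm: "y \<otimes> x \<otimes> inv y \<in> commutant G x"
  shows "x \<otimes> y = y \<otimes> x"
proof -
  obtain k :: nat where "0 < k" and lox: "loxodromic (x [^] k)"
    using exists_loxodromic_power[OF tf x] .
  define u where "u = x [^] int k"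
  have lox: "loxodromic u" using lox by (simp add: u_def int_pow_int)
  have u: "u \<in> carrier G" using x by (simp add: u_def)
  have u_comm: "commutant G x \<subseteq> commutant G u"
    using group_commutes_pow[of x _ k] x by (auto simp: commutant_def u_def int_pow_int)
  \<comment> \<open>This conjugate is a power of \<open>y \<otimes> x \<otimes> inv y\<close>, so it
    commutes with \<open>x\<close> and hence with the power \<open>u\<close> of
    \<open>x\<close>.\<close>
  have "y \<otimes> u \<otimes> inv y \<in> commutant G u"
    using int_pow_commutant[OF x(1) comm, of "int k"] conjugate_int_pow[OF x(1) y] u_comm
    by (auto simp: u_def)
  then obtain a b :: int where ab: "0 < a" "(y \<otimes> u \<otimes> inv y) [^] a = u [^] b"
    using power_in_cyclic_if_finite_index[OF u finite_ball loxodromic_commutant_cover[OF lox]] by metis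
  define v where "v = u [^] a"
  have conj: "y \<otimes> v \<otimes> inv y = u [^] b" using ab conjugate_int_pow[OF u y] by (simp add: v_def)
  have v: "v \<in> carrier G" "v \<noteq> \<one>"
    using u ab(1) torsion_free_int_pow[OF tf u] loxodromic_not_one[OF lox] by (auto simp: v_def)
  have xv: "x \<in> commutant G v"
    using int_pow_commutant[of x u a] u_comm x u commutant_sym[of u x] commutant_sym[of x v]
    by (auto simp: v_def commutant_def)
  have "\<bar>b\<bar> = a" using loxodromic_conjugate_power[OF lox y ab(1)] conj by (simp add: v_def)
  then consider "b = a" | "b = - a" by linarith
  then have "y \<otimes> v = v \<otimes> y"
  proof cases
    case 1
    then have "y \<otimes> v \<otimes> inv y = v" using conj by (simp add: v_def)
    then show ?thesis using y v by (metis inv_solve_right' m_closed)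
  next
    case 2
    then have "y \<otimes> v \<otimes> inv y = inv v" using conj u by (simp add: v_def int_pow_neg)
    \<comment> \<open>Inverting \<open>v\<close> twice, \<open>y \<otimes> y\<close> commutes with
      \<open>v\<close>. Its centralizer is abelian and contains both \<open>y\<close> and
      \<open>v\<close>.\<close>
    then have yv: "y \<otimes> v = inv v \<otimes> y" using y v by (metis inv_solve_right' m_closed inv_closed)
    then have "y \<otimes> inv v = v \<otimes> y" using y v by (metis inv_closed inv_solve_left inv_solve_right m_assoc m_closed)
    then have "(y \<otimes> y) \<otimes> v = v \<otimes> (y \<otimes> y)" using yv y v by (metis inv_closed m_assoc)
    then have "v \<in> commutant G (y \<otimes> y)" "y \<in> commutant G (y \<otimes> y)" using y v by (auto simp: commutant_def m_assoc)
    \<comment> \<open>Otherwise \<open>y\<close> is trivial, so \<open>v\<close> equals its inverse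
      and is torsion.\<close>
    moreover have "y \<otimes> y \<noteq> \<one>"
    proof
      assume "y \<otimes> y = \<one>"
      then have "y [^] (2::int) = \<one>" using y int_pow_mult[of y 1 1] by simp
      then have "y = \<one>" using torsion_free_int_pow[OF tf y, of 2] by simp
      then have "v = inv v" using yv v by simp
      then have "v [^] (2::int) = \<one>" using v int_pow_mult[of v 1 1] by (metis int_pow_1 l_inv one_add_one)
      then show False using torsion_free_int_pow[OF tf v(1), of 2] v(2) by simp
    qed
    ultimately show ?thesis using centralizer_commute[OF tf, of "y \<otimes> y" y v] y by simp
  qed
  then have "y \<in> commutant G v" using y v by (simp add: commutant_def)
  then show ?thesis using centralizer_commute[OF tf v xv] by simp
qed

lemma csa_group_if_torsion_free:
  assumes "torsion_free G"
  shows "csa_group G"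
proof (rule csa_groupI[OF is_group])
  show "y \<otimes> z = z \<otimes> y" if "x \<in> carrier G" "y \<in> carrier G" "z \<in> carrier G" "x \<noteq> \<one>"
    "x \<otimes> y = y \<otimes> x" "x \<otimes> z = z \<otimes> x" for x y z
    using centralizer_commute[OF assms, of x y z] that by (simp add: commutant_def)
  show "x \<otimes> y = y \<otimes> x" if "x \<in> carrier G" "y \<in> carrier G" "x \<noteq> \<one>"
    "x \<otimes> (y \<otimes> x \<otimes> inv y) = (y \<otimes> x \<otimes> inv y) \<otimes> x" for x y
    using conjugate_commute[OF assms, of x y] that by (simp add: commutant_def)
qed

end

lemma csa_group_torsion_free_hyperbolic:
  fixes G (structure)
  assumes tf: "torsion_free G" and hyp: "hyperbolic_group G"
  shows "csa_group G"
proof -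
  interpret group G using hyp by (simp add: hyperbolic_group_def)
  obtain X where "finite X" and X: "X \<subseteq> carrier G" "generate G X = carrier G"
    and "Gromov_hyperbolic_on (carrier G) (word_dist G X)"
    using hyp by (auto simp: hyperbolic_group_def)
  then obtain \<delta> where \<delta>: "0 \<le> \<delta>" "\<And>w x y z. \<lbrakk>w \<in> carrier G; x \<in> carrier G; y \<in> carrier G; z \<in> carrier G\<rbrakk>
      \<Longrightarrow> min (Gromov_product (word_dist G X) w x y) (Gromov_product (word_dist G X) w y z) - \<delta>
        \<le> Gromov_product (word_dist G X) w x z"
    unfolding Gromov_hyperbolic_on_def by blast
  interpret hyperbolic_length G "word_length G X" \<delta>
  proof
    show "word_length G X \<one> = 0" by (rule word_length_one[OF X])
    show "word_length G X (inv g) = word_length G X g" if "g \<in> carrier G" for g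
      by (rule word_length_inv[OF X that])
    show "word_length G X (g \<otimes> h) \<le> word_length G X g + word_length G X h"
      if "g \<in> carrier G" "h \<in> carrier G" for g h by (rule word_length_mult[OF X that])
    show "\<exists>c\<in>carrier G. word_length G X c \<le> n \<and> word_length G X (inv c \<otimes> g) \<le> word_length G X g - n"
      if "g \<in> carrier G" "n \<le> word_length G X g" for g n
      using word_length_split[OF X that] by metis
    show "finite {g \<in> carrier G. word_length G X g \<le> n}" for n
      by (rule finite_word_length_ball[OF X \<open>finite X\<close>])
    show "0 \<le> \<delta>" by fact
    fix x y z t assume G: "x \<in> carrier G" "y \<in> carrier G" "z \<in> carrier G" "t \<in> carrier G"
    \<comment> \<open>Gromov's inequality with base point \<open>t\<close>, doubled and
      rearranged.\<close>
    show "real (word_length G X (inv x \<otimes> z)) + real (word_length G X (inv y \<otimes> t))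
      \<le> max (real (word_length G X (inv x \<otimes> y)) + real (word_length G X (inv z \<otimes> t)))
         (real (word_length G X (inv y \<otimes> z)) + real (word_length G X (inv x \<otimes> t))) + 2 * \<delta>"
      using \<delta>(2)[OF G(4,1,2,3)] unfolding Gromov_product_def word_dist_def
      by (simp add: min_def max_def field_simps split: if_splits)
  qed
  show ?thesis using tf by (rule csa_group_if_torsion_free)
qed

theorem proposition12:
  fixes G :: "('a, 'm) monoid_scheme"
    and X :: "'p set"
    and d :: "'p \<Rightarrow> 'p \<Rightarrow> 'l::linordered_ab_group_add"
    and \<phi> :: "'a \<Rightarrow> 'p \<Rightarrow> 'p"
  assumes "group G"
  shows "(torsion_free G \<and> hyperbolic_group G \<longrightarrow> csa_group G)
       \<and> (lambda_tree X d \<and> acts_freely_on_tree G X d \<phi> \<longrightarrow> csa_group G)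
       \<and> (universally_free TYPE('f) G \<longrightarrow> csa_group G)"
  using csa_group_torsion_free_hyperbolic csa_group_free_tree_action csa_group_universally_free assms
  by blast

end
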